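(* Let $K$ be a field, $S=K[t_1,\ldots,t_s]$, and let $I=I(L)=(f_1,\ldots,f_s)$ be the ideal of an $s\times s$ GPCB matrix $L$ with diagonal entries $a_{i,i}$ and off-diagonal entries $-a_{i,j}$. Let $\mathbf{b}=(b_1,\ldots,b_s)$ be the vector of positive integers with $\gcd(\mathbf{b})=1$ and $L\mathbf{b}^\top=0$; if ${\rm char}(K)=p>0$, assume $p\nmid b_s$. Let $\mathcal{L}$ be the lattice spanned by the columns of $L$ and set $J=(f_1,\ldots,f_{s-1})$. Suppose that $g\in(J:f_s)$ is such that $g\notin\mathfrak{p}$ for any minimal prime $\mathfrak{p}$ over $I$. Then the following hold. (a) $I(\mathcal{L})={\rm Hull}(I)=(I:g)=(J:g)$. (b) Let $g_s=\sum_{j=1}^{b_s}x_s^{b_s-j}y_s^{j-1}$, where $x_s=t_s^{a_{s,s}}$ and $y_s=t_1^{a_{1,s}}\cdots t_{s-1}^{a_{s-1,s}}$ (so $g_s=1$ if $b_s=1$), and let $$b(s)=(0,\,b_{2,2}-b_{2,3}-\cdots-b_{2,s},\,b_{3,3}-b_{3,4}-\cdots-b_{3,s},\,\ldots,\,b_{s-1,s-1}-b_{s-1,s},\,0)\in\mathbb{N}^s,$$ where $b_{i,i}$ and $-b_{i,j}$ ($i\ne j$) are the entries of $\widetilde{L}=L\,{\rm diag}(b_1,\ldots,b_s)$. Then $I(\mathcal{L})=(I:t^{b(s)}g_s)=(J:t^{b(s)}g_s)$.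
   Context: A GPCB (generalized positive critical binomial) matrix is an $s\times s$ integer matrix $L$ with diagonal entries $a_{i,i}>0$ and off-diagonal entries $-a_{i,j}<0$ ($i\ne j$, $a_{i,j}$ positive integers) such that $L\mathbf{b}^\top=0$ for some vector $\mathbf{b}$ of positive integers. The matrix ideal of $L$ is $I(L)=(f_1,\ldots,f_s)$, where $f_i=t_i^{a_{i,i}}-\prod_{j\ne i}t_j^{a_{j,i}}$ is the binomial defined by the $i$-th column of $L$. For $a\in\mathbb{Z}^s$ write $a=a^+-a^-$ with $a^\pm\in\mathbb{N}^s$ of disjoint support; the lattice ideal of a subgroup $\mathcal{L}\subset\mathbb{Z}^s$ is $I(\mathcal{L})=(t^{a^+}-t^{a^-}\mid a\in\mathcal{L})$. ${\rm Hull}(I)$ is the intersection of the isolated primary components of $I$. $(I:h)=\{f\in S\mid fh\in I\}$. $\mathbb{N}=\{0,1,\ldots\}$, $t^c=t_1^{c_1}\cdots t_s^{c_s}$. *)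

theory Defs
  imports
    "HOL-Analysis.Analysis"
    "HOL-Algebra.Ideal"
    "HOL-Decision_Procs.Algebra_Aux"
    "HOL-Library.Poly_Mapping"
begin

section \<open>Colon ideals, primary decomposition, and the hull of an ideal\<close>

definition colon_ideal :: "('r, 'm) ring_scheme \<Rightarrow> 'r set \<Rightarrow> 'r \<Rightarrow> 'r set" where
  "colon_ideal R I h = {f \<in> carrier R. f \<otimes>\<^bsub>R\<^esub> h \<in> I}"

definition radical :: "('r, 'm) ring_scheme \<Rightarrow> 'r set \<Rightarrow> 'r set" where
  "radical R I = {x \<in> carrier R. \<exists>n::nat. x [^]\<^bsub>R\<^esub> n \<in> I}"

definition minimal_prime_over :: "('r, 'm) ring_scheme \<Rightarrow> 'r set \<Rightarrow> 'r set \<Rightarrow> bool" where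
  "minimal_prime_over R I P \<longleftrightarrow>
     primeideal P R \<and> I \<subseteq> P \<and>
     (\<forall>P'. primeideal P' R \<and> I \<subseteq> P' \<and> P' \<subseteq> P \<longrightarrow> P' = P)"

definition primary_ideal :: "('r, 'm) ring_scheme \<Rightarrow> 'r set \<Rightarrow> bool" where
  "primary_ideal R Q \<longleftrightarrow>
     ideal Q R \<and> Q \<noteq> carrier R \<and>
     (\<forall>x\<in>carrier R. \<forall>y\<in>carrier R. x \<otimes>\<^bsub>R\<^esub> y \<in> Q \<longrightarrow> x \<in> Q \<or> y \<in> radical R Q)"

text \<open>Irredundant primary decompositions: the primary ideals have pairwise distinct radicals, and
  none of them can be omitted.  Intersecting with the carrier makes the empty
  intersection the unit ideal.\<close>

definition primary_decomposition :: "('r, 'm) ring_scheme \<Rightarrow> 'r set \<Rightarrow> 'r set set \<Rightarrow> bool" where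
  "primary_decomposition R I D \<longleftrightarrow>
     finite D \<and> (\<forall>Q\<in>D. primary_ideal R Q) \<and>
     carrier R \<inter> \<Inter>D = I \<and>
     inj_on (radical R) D \<and>
     (\<forall>Q\<in>D. \<not> carrier R \<inter> \<Inter>(D - {Q}) \<subseteq> Q)"

text \<open>A component is isolated if its radical is minimal among the associated primes, i.e. the
  radicals of the components.\<close>

definition isolated_primary_component :: "('r, 'm) ring_scheme \<Rightarrow> 'r set \<Rightarrow> 'r set \<Rightarrow> bool" where
  "isolated_primary_component R I Q \<longleftrightarrow>
     (\<exists>D. primary_decomposition R I D \<and> Q \<in> D \<and>
        (\<forall>Q'\<in>D. radical R Q' \<subseteq> radical R Q \<longrightarrow> radical R Q' = radical R Q))"

text \<open>The isolated components do not depend on the irredundant decomposition, so no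
  decomposition has to be chosen here.\<close>

definition hull_ideal :: "('r, 'm) ring_scheme \<Rightarrow> 'r set \<Rightarrow> 'r set" where
  "hull_ideal R I = carrier R \<inter> \<Inter>{Q. isolated_primary_component R I Q}"


section \<open>Polynomials\<close>

text \<open>The variables are indexed by a finite linearly ordered type \<open>'n\<close>, which plays the role of
  \<open>{1, \<dots>, s}\<close>: the number of variables is \<open>CARD('n)\<close>, and the indices \<open>1\<close> and \<open>s\<close> are
  \<open>Min UNIV\<close> and \<open>Max UNIV\<close>.  A polynomial maps exponent vectors to coefficients, and
  multiplication is the convolution product of \<open>Poly_Mapping\<close>.\<close>

type_synonym ('n, 'k) mpoly = "('n \<Rightarrow>\<^sub>0 nat) \<Rightarrow>\<^sub>0 'k"

abbreviation poly_ring :: "('n, 'k::comm_ring_1) mpoly ring" where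
  "poly_ring \<equiv> cring_class_ops"

definition var :: "'n \<Rightarrow> ('n, 'k::comm_ring_1) mpoly" where
  "var i = Poly_Mapping.single (Poly_Mapping.single i 1) 1"

definition monomial :: "('n::finite \<Rightarrow> nat) \<Rightarrow> ('n, 'k::comm_ring_1) mpoly" where
  "monomial c = (\<Prod>i\<in>UNIV. var i ^ c i)"


section \<open>Matrix ideals and lattice ideals\<close>

definition GPCB :: "int ^ 'n ^ 'n \<Rightarrow> bool" where
  "GPCB L \<longleftrightarrow>
     (\<forall>i. L $ i $ i > 0) \<and> (\<forall>i j. i \<noteq> j \<longrightarrow> L $ i $ j < 0) \<and>
     (\<exists>b :: int ^ 'n. (\<forall>i. b $ i > 0) \<and> L *v b = 0)"

text \<open>The off-diagonal entry of \<open>L\<close> at \<open>(j, i)\<close> is \<open>- a\<^sub>j\<^sub>,\<^sub>i\<close>, hence the sign in the exponent.\<close>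

definition matrix_binomial :: "int ^ 'n ^ 'n \<Rightarrow> 'n::finite \<Rightarrow> ('n, 'k::comm_ring_1) mpoly" where
  "matrix_binomial L i =
     var i ^ nat (L $ i $ i) - (\<Prod>j\<in>UNIV - {i}. var j ^ nat (- (L $ j $ i)))"

definition matrix_ideal :: "int ^ 'n ^ 'n \<Rightarrow> ('n::finite, 'k::comm_ring_1) mpoly set" where
  "matrix_ideal L = Idl\<^bsub>poly_ring\<^esub> (range (matrix_binomial L))"

definition column_lattice :: "int ^ 'n ^ 'n \<Rightarrow> (int ^ 'n) set" where
  "column_lattice L = {\<Sum>j\<in>UNIV. c j *s column j L | c :: 'n \<Rightarrow> int. True}"

definition lattice_ideal :: "(int ^ 'n) set \<Rightarrow> ('n::finite, 'k::comm_ring_1) mpoly set" where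
  "lattice_ideal \<L> =
     Idl\<^bsub>poly_ring\<^esub> {monomial (\<lambda>i. nat (a $ i)) - monomial (\<lambda>i. nat (- (a $ i))) | a. a \<in> \<L>}"

definition scaled_matrix :: "int ^ 'n ^ 'n \<Rightarrow> int ^ 'n \<Rightarrow> int ^ 'n ^ 'n" where
  "scaled_matrix L b = L ** (\<chi> i j. if i = j then b $ i else 0)"

text \<open>The vector \<open>b(s)\<close>.  The off-diagonal entries of \<open>scaled_matrix L b\<close> are \<open>- b\<^sub>i\<^sub>,\<^sub>j\<close>.\<close>

definition b_exponent ::
    "((int, 'n) vec, 'n) vec \<Rightarrow> (int, 'n) vec \<Rightarrow> 'n::{finite,linorder} \<Rightarrow> int" where
  "b_exponent L b i =
     (if i = Min UNIV \<or> i = Max UNIV then 0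
      else scaled_matrix L b $ i $ i - (\<Sum>j\<in>{i<..}. - (scaled_matrix L b $ i $ j)))"

end

theory Submission
  imports Defs
begin

text \<open>
  Let \<open>T = K[t\<^sub>s]\<close>.  Rewriting \<open>x\<^sub>k\<close> to \<open>y\<^sub>k\<close> for \<open>k \<noteq> s\<close> shows that \<open>S/J\<close> is a finitely generated
  \<open>T\<close>-module, and since the \<open>f\<^sub>k\<close> are powers of distinct variables modulo \<open>t\<^sub>s\<close>, the variable \<open>t\<^sub>s\<close> is a
  nonzerodivisor modulo \<open>J\<close>.  As \<open>t\<^sub>j\<^bsup>N\<^esup>\<close> is congruent modulo \<open>I\<close> to a multiple of any given monomial
  for large \<open>N\<close>, every \<open>u\<close> in the lattice ideal has \<open>t\<^sub>s\<^bsup>M\<^esup> u \<in> I\<close> for some \<open>M\<close>.  Together these give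
  \<open>I(\<L>) \<subseteq> (J : g)\<close> for every \<open>g \<in> (J : f\<^sub>s)\<close>.  For \<open>h = t\<^bsup>b(s)\<^esup> g\<^sub>s\<close>, the product \<open>h f\<^sub>s\<close> lies in \<open>J\<close>
  by a telescoping substitution, and \<open>h\<close> is \<open>b\<^sub>s\<close> times a monomial modulo \<open>I(\<L>)\<close>, so
  \<open>(I : h) \<subseteq> I(\<L>)\<close>.

  For the hull, \<open>S/I(\<L>)\<close> is torsion-free over \<open>T\<close>, because \<open>L\<close> has a positive left null vector and
  hence \<open>I(\<L>)\<close> is homogeneous for a positive grading.  Ideals containing \<open>J\<close> with \<open>T\<close>-torsion-free
  quotient satisfy the ascending chain condition by counting ranks, hence decompose into primary
  ideals of the same kind, whose radicals are pairwise incomparable.  Finally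
  \<open>I = I(\<L>) \<inter> (I + (t\<^sup>c))\<close> for a suitable monomial \<open>t\<^sup>c\<close>, and the second ideal is primary to the
  ideal of all variables.
\<close>

section \<open>Ideals and primary decomposition in commutative rings\<close>

text \<open>A commutative ring is a module over itself; its ideals are the subspaces and generated
  ideals the spans, so results on modules apply.\<close>

interpretation idl: module "times :: 'a::comm_ring_1 \<Rightarrow> 'a \<Rightarrow> 'a"
  by unfold_locales (simp_all add: algebra_simps)

text \<open>As simplification rule this would reverse \<open>mult.assoc\<close>.\<close>

declare idl.scale_scale [simp del]

abbreviation rad :: "'a::comm_ring_1 set \<Rightarrow> 'a set" where
  "rad \<equiv> radical cring_class_ops"

lemma ideal_iff_subspace:
  "ideal A cring_class_ops \<longleftrightarrow> idl.subspace (A :: 'a::comm_ring_1 set)"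
proof
  assume A: "ideal A (cring_class_ops :: 'a ring)"
  then interpret A: ideal A "cring_class_ops :: 'a ring" .
  show "idl.subspace A"
  proof (rule idl.subspaceI)
    show "0 \<in> A" using A.zero_closed by (simp add: zero_class)
    show "x + y \<in> A" if "x \<in> A" "y \<in> A" for x y
      using A.a_closed[OF that] by (simp add: plus_class)
    show "c * x \<in> A" if "x \<in> A" for c x
      using A.I_l_closed[OF that, of c] by (simp add: times_class carrier_class)
  qed
next
  assume A: "idl.subspace A"
  have neg: "\<ominus>\<^bsub>cring_class_ops\<^esub> x = - x" for x :: 'a by (rule uminus_class)
  show "ideal A (cring_class_ops :: 'a ring)"
  proof (rule idealI)
    show "ring (cring_class_ops :: 'a ring)" using cring_class cring.axioms by blast
    show "subgroup A (add_monoid (cring_class_ops :: 'a ring))"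
    proof (intro group.subgroupI)
      show "group (add_monoid (cring_class_ops :: 'a ring))"
        using cring_class by (intro abelian_group.a_group ring.is_abelian_group cring.axioms(1))
      show "A \<noteq> {}" using idl.subspace_0[OF A] by blast
      show "inv\<^bsub>add_monoid cring_class_ops\<^esub> a \<in> A" if "a \<in> A" for a
        using idl.subspace_neg[OF A that] neg[of a] by (simp add: a_inv_def)
    qed (use idl.subspace_add[OF A] in \<open>auto simp: cring_class_ops_def\<close>)
    show "x \<otimes>\<^bsub>cring_class_ops\<^esub> a \<in> A" if "a \<in> A" for a x
      using idl.subspace_scale[OF A that] by (simp add: times_class)
    show "a \<otimes>\<^bsub>cring_class_ops\<^esub> x \<in> A" if "a \<in> A" for a x
      using idl.subspace_scale[OF A that, of x] by (simp add: times_class mult.commute)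
  qed
qed

lemma Idl_eq_span: "Idl\<^bsub>cring_class_ops\<^esub> S = idl.span (S :: 'a::comm_ring_1 set)"
proof -
  have "idl.span S = \<Inter>{A. idl.subspace A \<and> S \<subseteq> A}"
    by (auto simp: idl.span_def hull_def)
  then show ?thesis unfolding genideal_def ideal_iff_subspace by simp
qed

lemma carrier_cring_class: "carrier cring_class_ops = UNIV"
  by (simp add: cring_class_ops_def)

lemma subspace_eq_UNIV_iff: "idl.subspace A \<Longrightarrow> A = UNIV \<longleftrightarrow> (1 :: 'a::comm_ring_1) \<in> A"
  using idl.subspace_scale[of A 1] by fastforce

lemma primeideal_iff:
  "primeideal P cring_class_ops \<longleftrightarrow>
     idl.subspace P \<and> (1 :: 'a::comm_ring_1) \<notin> P \<and> (\<forall>x y. x * y \<in> P \<longrightarrow> x \<in> P \<or> y \<in> P)"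
  unfolding primeideal_def primeideal_axioms_def ideal_iff_subspace carrier_cring_class times_class
  using subspace_eq_UNIV_iff[of P] cring_class by auto

lemma rad_eq: "rad Q = {x. \<exists>n. x ^ n \<in> Q}"
  by (simp add: radical_def carrier_cring_class power_class)

lemma primary_ideal_iff:
  "primary_ideal cring_class_ops Q \<longleftrightarrow>
     idl.subspace Q \<and> (1 :: 'a::comm_ring_1) \<notin> Q \<and>
     (\<forall>x y. x * y \<in> Q \<longrightarrow> x \<in> Q \<or> (\<exists>n. y ^ n \<in> Q))"
  unfolding primary_ideal_def ideal_iff_subspace carrier_cring_class times_class rad_eq
  using subspace_eq_UNIV_iff[of Q] by auto

lemma colon_ideal_eq: "colon_ideal cring_class_ops A h = {x. x * h \<in> A}"
  by (simp add: colon_ideal_def carrier_cring_class times_class)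

lemma subset_rad: "Q \<subseteq> rad Q"
  unfolding rad_eq using power_one_right by (metis (mono_tags, lifting) mem_Collect_eq subsetI)

lemma power_mem_ge: "idl.subspace A \<Longrightarrow> x ^ n \<in> A \<Longrightarrow> n \<le> m \<Longrightarrow> (x :: 'a::comm_ring_1) ^ m \<in> A"
  using idl.subspace_scale[of A "x ^ n" "x ^ (m - n)"] by (simp flip: power_add)

lemma prime_power_mem:
  assumes "primeideal P cring_class_ops" and "(x :: 'a::comm_ring_1) ^ n \<in> P"
  shows "x \<in> P"
  using assms(2) by (induction n) (use assms(1) in \<open>auto simp: primeideal_iff\<close>)

lemma rad_subset_prime:
  "primeideal P cring_class_ops \<Longrightarrow> Q \<subseteq> P \<Longrightarrow> rad Q \<subseteq> (P :: 'a::comm_ring_1 set)"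
  unfolding rad_eq using prime_power_mem by blast

lemma subspace_rad:
  assumes sub: "idl.subspace (Q :: 'a::comm_ring_1 set)"
  shows "idl.subspace (rad Q)"
proof (rule idl.subspaceI)
  show "0 \<in> rad Q" using subset_rad idl.subspace_0[OF sub] by blast
  show "x + y \<in> rad Q" if xy: "x \<in> rad Q" "y \<in> rad Q" for x y
  proof -
    obtain m n where m: "x ^ m \<in> Q" and n: "y ^ n \<in> Q" using xy by (auto simp: rad_eq)
    have "x ^ k * y ^ (m + n - k) \<in> Q" if "k \<le> m + n" for k
    proof (cases "m \<le> k")
      case True
      then show ?thesis
        using idl.subspace_scale[OF sub power_mem_ge[OF sub m True], of "y ^ (m + n - k)"]
        by (simp add: mult.commute)
    next
      case False
      then have "n \<le> m + n - k" by simp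
      then show ?thesis using idl.subspace_scale[OF sub power_mem_ge[OF sub n]] by blast
    qed
    then have "(x + y) ^ (m + n) \<in> Q"
      unfolding binomial_ring
      by (intro idl.subspace_sum[OF sub]) (simp add: mult.assoc idl.subspace_scale[OF sub])
    then show ?thesis by (auto simp: rad_eq)
  qed
  show "c * x \<in> rad Q" if "x \<in> rad Q" for c x
    using that idl.subspace_scale[OF sub] by (fastforce simp: rad_eq power_mult_distrib)
qed

lemma primeideal_rad:
  assumes Q: "primary_ideal cring_class_ops (Q :: 'a::comm_ring_1 set)"
  shows "primeideal (rad Q) cring_class_ops"
  unfolding primeideal_iff
proof (intro conjI allI impI)
  show "idl.subspace (rad Q)" using Q by (intro subspace_rad) (simp add: primary_ideal_iff)
  show "1 \<notin> rad Q" using Q by (simp add: rad_eq primary_ideal_iff)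
  show "x \<in> rad Q \<or> y \<in> rad Q" if "x * y \<in> rad Q" for x y
  proof -
    from that obtain n where "x ^ n * y ^ n \<in> Q" by (auto simp: rad_eq power_mult_distrib)
    then have "x ^ n \<in> Q \<or> (\<exists>k. (y ^ n) ^ k \<in> Q)" using Q unfolding primary_ideal_iff by blast
    then show ?thesis by (auto simp: rad_eq simp flip: power_mult)
  qed
qed

lemma rad_Int:
  assumes "idl.subspace A" and "idl.subspace B"
  shows "rad (A \<inter> B) = rad A \<inter> rad (B :: 'a::comm_ring_1 set)"
proof -
  have "x ^ max m n \<in> A \<inter> B" if "x ^ m \<in> A" "x ^ n \<in> B" for x m n
    using power_mem_ge[OF assms(1) that(1), of "max m n"]
      power_mem_ge[OF assms(2) that(2), of "max m n"] by simp
  then show ?thesis unfolding rad_eq by blast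
qed

text \<open>If \<open>x\<close> is missing from either component, \<open>y\<close> lies in the
  common radical, which is also that of the intersection. Components with equal radicals are merged
  this way.\<close>

lemma primary_ideal_Int:
  assumes A: "primary_ideal cring_class_ops A" and B: "primary_ideal cring_class_ops B"
    and eq: "rad A = rad (B :: 'a::comm_ring_1 set)"
  shows "primary_ideal cring_class_ops (A \<inter> B)"
proof -
  have sub: "idl.subspace A" "idl.subspace B" using A B by (auto simp: primary_ideal_iff)
  have r: "rad (A \<inter> B) = rad A" using rad_Int[OF sub] eq by simp
  have "x \<in> A \<inter> B \<or> y \<in> rad (A \<inter> B)" if "x * y \<in> A \<inter> B" for x y
  proof -
    have "x \<in> A \<or> y \<in> rad A" "x \<in> B \<or> y \<in> rad B"
      using that A B by (auto simp: primary_ideal_iff rad_eq)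
    then show ?thesis using r eq by auto
  qed
  moreover have "1 \<notin> A" using A by (simp add: primary_ideal_iff)
  ultimately show ?thesis
    using idl.subspace_inter[OF sub] unfolding primary_ideal_iff rad_eq by blast
qed

text \<open>If each member had an element outside \<open>P\<close>, the product of these elements
  would lie in the intersection but, by primality, not in \<open>P\<close>.\<close>

lemma prime_contains_of_Inter:
  assumes P: "primeideal P cring_class_ops" and "finite D"
    and "\<forall>Q\<in>D. idl.subspace Q" and "\<Inter>D \<subseteq> (P :: 'a::comm_ring_1 set)"
  shows "\<exists>Q\<in>D. Q \<subseteq> P"
proof (rule ccontr)
  assume neg: "\<not> ?thesis"
  have "\<exists>e. e \<in> \<Inter>D \<and> e \<notin> P" using \<open>finite D\<close> assms(3) neg
  proof (induction D)
    case empty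
    then show ?case using P by (auto simp: primeideal_iff)
  next
    case (insert Q D)
    then obtain e q where e: "e \<in> \<Inter>D" "e \<notin> P" and q: "q \<in> Q" "q \<notin> P" by auto
    have "e * q \<notin> P" using e q P by (auto simp: primeideal_iff)
    moreover have "e * q \<in> Q" using insert.prems(1) q idl.subspace_scale by auto
    moreover have "e * q \<in> \<Inter>D"
      using insert.prems(1) e idl.subspace_scale[of _ e q] by (auto simp: mult.commute)
    ultimately show ?case by blast
  qed
  with assms(4) show False by blast
qed

section \<open>Irredundant primary decompositions and isolated components\<close>

lemma primary_decomposition_iff:
  "primary_decomposition cring_class_ops A D \<longleftrightarrow>
     finite D \<and> (\<forall>Q\<in>D. primary_ideal cring_class_ops Q) \<and> \<Inter>D = A \<and>
     inj_on rad D \<and> (\<forall>Q\<in>D. \<not> \<Inter>(D - {Q}) \<subseteq> (Q :: 'a::comm_ring_1 set))"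
  by (simp add: primary_decomposition_def carrier_cring_class)

text \<open>A prime between \<open>A\<close> and \<open>rad Q\<close> contains some component
  \<open>Q'\<close>, hence \<open>rad Q'\<close>; isolation then squeezes it to
  \<open>rad Q\<close>.\<close>

lemma minimal_prime_over_rad_isolated:
  assumes D: "primary_decomposition cring_class_ops A D" and QD: "Q \<in> D"
    and isolated: "\<forall>Q'\<in>D. rad Q' \<subseteq> rad Q \<longrightarrow> rad Q' = rad (Q :: 'a::comm_ring_1 set)"
  shows "minimal_prime_over cring_class_ops A (rad Q)"
  unfolding minimal_prime_over_def
proof (intro conjI allI impI)
  show "primeideal (rad Q) cring_class_ops"
    using D QD primeideal_rad by (auto simp: primary_decomposition_iff)
  show "A \<subseteq> rad Q" using D QD subset_rad by (auto simp: primary_decomposition_iff)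
  fix P assume P: "primeideal P cring_class_ops \<and> A \<subseteq> P \<and> P \<subseteq> rad Q"
  then obtain Q' where "Q' \<in> D" "Q' \<subseteq> P"
    using prime_contains_of_Inter[of P D] D by (auto simp: primary_decomposition_iff primary_ideal_iff)
  then have "rad Q' \<subseteq> P" using rad_subset_prime P by (elim conjE)
  moreover have "P \<subseteq> rad Q" using P by (elim conjE)
  moreover from calculation have "rad Q' \<subseteq> rad Q" by (rule order_trans)
  ultimately show "P = rad Q" using isolated[rule_format, OF \<open>Q' \<in> D\<close>] subset_antisym by metis
qed

text \<open>A decomposition with the fewest components is irredundant; the predicate \<open>C\<close> lets one keep
  track of a property of the components.\<close>

lemma primary_decomposition_exists:
  assumes fin: "finite D" and prim: "\<forall>Q\<in>D. primary_ideal cring_class_ops Q \<and> C Q"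
    and Int: "\<And>Q Q'. primary_ideal cring_class_ops Q \<Longrightarrow> primary_ideal cring_class_ops Q' \<Longrightarrow>
      C Q \<Longrightarrow> C Q' \<Longrightarrow> rad Q = rad Q' \<Longrightarrow> C (Q \<inter> Q')"
  shows "\<exists>D'. primary_decomposition cring_class_ops (\<Inter>D) D' \<and> (\<forall>Q\<in>D'. C (Q :: 'a::comm_ring_1 set))"
proof -
  define ok where "ok D' \<longleftrightarrow> finite D' \<and> (\<forall>Q\<in>D'. primary_ideal cring_class_ops Q \<and> C Q) \<and>
    \<Inter>D' = \<Inter>D" for D'
  have "ok D" using fin prim by (simp add: ok_def)
  then obtain E where E: "ok E" and least: "\<And>D'. ok D' \<Longrightarrow> card E \<le> card D'"
    using ex_has_least_nat[of ok D card] by blast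
  have finE: "finite E" using E by (simp add: ok_def)
  have irr: "\<not> \<Inter>(E - {Q}) \<subseteq> Q" if "Q \<in> E" for Q
  proof
    assume "\<Inter>(E - {Q}) \<subseteq> Q"
    then have "\<Inter>(E - {Q}) = \<Inter>E" using that by blast
    then have "ok (E - {Q})" using E by (auto simp: ok_def)
    then show False using least[of "E - {Q}"] card_Diff1_less[OF finE that] by simp
  qed
  have "inj_on rad E"
  proof (rule inj_onI, rule ccontr)
    fix Q Q' assume QQ: "Q \<in> E" "Q' \<in> E" "rad Q = rad Q'" "Q \<noteq> Q'"
    \<comment> \<open>Merging \<open>Q\<close> and \<open>Q'\<close> saves one component, against
      the minimality of \<open>E\<close>.\<close>
    define D' where "D' = insert (Q \<inter> Q') (E - {Q, Q'})"
    have "E = insert Q (insert Q' (E - {Q, Q'}))" using QQ by blast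
    then have "\<Inter>E = Q \<inter> (Q' \<inter> \<Inter>(E - {Q, Q'}))" by (metis Inter_insert)
    then have "\<Inter>D' = \<Inter>E" unfolding D'_def by (simp add: Int_assoc)
    moreover have "primary_ideal cring_class_ops (Q \<inter> Q') \<and> C (Q \<inter> Q')"
      using E QQ primary_ideal_Int[of Q Q'] Int[of Q Q'] unfolding ok_def by blast
    ultimately have "ok D'" using E unfolding ok_def D'_def by simp
    moreover have "card D' \<le> Suc (card (E - {Q, Q'}))"
      using finE unfolding D'_def by (simp add: card_insert_le_m1 card_insert_if)
    moreover have "card (E - {Q, Q'}) = card E - 2" "card E \<ge> 2"
      using QQ finE card_Diff_subset[of "{Q, Q'}" E] card_mono[of E "{Q, Q'}"] by simp_all
    ultimately show False using least[of D'] by simp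
  qed
  then have "primary_decomposition cring_class_ops (\<Inter>D) E"
    using E irr unfolding ok_def primary_decomposition_iff by simp
  then show ?thesis using E unfolding ok_def by blast
qed

text \<open>By \<open>unit\<close>, every \<open>y\<close> outside \<open>rad Q\<close> is
  invertible modulo \<open>rad Q\<close>. Expanding \<open>(z * y - 1) ^ n\<close> gives a multiple
  of \<open>y\<close> plus the unit \<open>(- 1) ^ n\<close>, so \<open>y\<close> is invertible
  modulo \<open>Q\<close> itself and cancels from \<open>x * y\<close>.\<close>

lemma primary_ideal_of_maximal_rad:
  assumes Q: "idl.subspace Q" and "1 \<notin> Q" and unit: "\<And>y. y \<notin> rad Q \<Longrightarrow> \<exists>z. z * y - 1 \<in> rad Q"
  shows "primary_ideal cring_class_ops (Q :: 'a::comm_ring_1 set)"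
  unfolding primary_ideal_iff
proof (intro conjI allI impI)
  fix x y assume xy: "x * y \<in> Q"
  show "x \<in> Q \<or> (\<exists>n. y ^ n \<in> Q)"
  proof (cases "y \<in> rad Q")
    case False
    then obtain z where "z * y - 1 \<in> rad Q" using unit by blast
    then obtain n where zn: "(z * y - 1) ^ n \<in> Q" by (auto simp: rad_eq)
    have "\<exists>r. (z * y - 1) ^ n = r * y + (- 1) ^ n"
    proof (induction n)
      case (Suc n)
      then obtain r where "(z * y - 1) ^ n = r * y + (- 1) ^ n" by (elim exE)
      then have "(z * y - 1) ^ Suc n = (z * y - 1) * (r * y + (- 1) ^ n)" by (simp only: power_Suc)
      also have "\<dots> = (z * (r * y + (- 1) ^ n) - r) * y + (- 1) ^ Suc n"
        by (simp add: algebra_simps)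
      finally show ?case by (rule exI)
    next
      case 0
      show ?case by (rule exI[of _ 0]) simp
    qed
    then obtain r where r: "(z * y - 1) ^ n = r * y + (- 1) ^ n" by (elim exE)
    have "x * (z * y - 1) ^ n - r * (x * y) \<in> Q"
      by (intro idl.subspace_diff[OF Q] idl.subspace_scale[OF Q zn] idl.subspace_scale[OF Q xy])
    moreover have "x * (z * y - 1) ^ n - r * (x * y) = x * (- 1) ^ n"
      unfolding r by (simp add: distrib_left mult_ac)
    ultimately have "x * (- 1) ^ n \<in> Q" by simp
    then have "(- 1) ^ n * (x * (- 1) ^ n) \<in> Q" using idl.subspace_scale[OF Q] by blast
    moreover have "(- 1) ^ n * (x * (- 1) ^ n) = x"
      by (cases "even n") simp_all
    ultimately show ?thesis by simp
  qed (auto simp: rad_eq)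
qed (use assms in auto)


lemma hull_ideal_eq:
  "hull_ideal cring_class_ops (I :: 'a::comm_ring_1 set) = {u. \<forall>Q. isolated_primary_component cring_class_ops I Q \<longrightarrow> u \<in> Q}"
  by (auto simp: hull_ideal_def carrier_cring_class)

lemma isolated_primary_component_contains:
  assumes "isolated_primary_component cring_class_ops I Q"
  shows "primary_ideal cring_class_ops Q" and "I \<subseteq> (Q :: 'a::comm_ring_1 set)"
    and "minimal_prime_over cring_class_ops I (rad Q)"
proof -
  obtain D where D: "primary_decomposition cring_class_ops I D" "Q \<in> D"
      "\<forall>Q'\<in>D. rad Q' \<subseteq> rad Q \<longrightarrow> rad Q' = rad Q"
    using assms unfolding isolated_primary_component_def by blast
  then show "minimal_prime_over cring_class_ops I (rad Q)" by (rule minimal_prime_over_rad_isolated)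
  show "primary_ideal cring_class_ops Q" "I \<subseteq> Q"
    using D by (auto simp: primary_decomposition_iff)
qed

text \<open>The radicals of isolated components are minimal primes, so they avoid \<open>g\<close>,
  and primariness cancels \<open>g\<close> from \<open>u * g\<close>.\<close>

lemma colon_subset_hull:
  fixes g :: "'a::comm_ring_1"
  assumes "\<And>P. minimal_prime_over cring_class_ops I P \<Longrightarrow> g \<notin> P" and "u * g \<in> I"
  shows "u \<in> hull_ideal cring_class_ops I"
  unfolding hull_ideal_eq
proof clarify
  fix Q assume Q: "isolated_primary_component cring_class_ops I Q"
  have "u * g \<in> Q" using isolated_primary_component_contains(2)[OF Q] assms(2) by blast
  then have "u \<in> Q \<or> g \<in> rad Q"
    using isolated_primary_component_contains(1)[OF Q] unfolding primary_ideal_iff rad_eq by blast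
  then show "u \<in> Q" using assms(1) isolated_primary_component_contains(3)[OF Q] by blast
qed


lemma power_diff_factor:
  fixes x y :: "'a::comm_ring_1"
  shows "(x - y) * (\<Sum>j = 1..n. x ^ (n - j) * y ^ (j - 1)) = x ^ n - y ^ n"
proof -
  have "(\<Sum>j = 1..n. x ^ (n - j) * y ^ (j - 1)) = (\<Sum>i<n. x ^ (n - Suc i) * y ^ i)"
    by (rule sum.reindex_bij_witness[of _ Suc "\<lambda>j. j - 1"]) auto
  moreover have "y ^ n - x ^ n = (y - x) * (\<Sum>i<n. x ^ (n - Suc i) * y ^ i)" by (rule power_diff_sumr2)
  ultimately show ?thesis by (simp add: algebra_simps)
qed

text \<open>Modulo \<open>A\<close> all \<open>n\<close> summands agree with
  \<open>x ^ (n - 1)\<close>. This will turn \<open>g\<^sub>s\<close> into a scalar times a power of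
  \<open>x\<^sub>s\<close> modulo the lattice ideal.\<close>

lemma power_sum_cong:
  fixes x y :: "'a::comm_ring_1"
  assumes A: "idl.subspace A" and xy: "x - y \<in> A"
  shows "(\<Sum>j = 1..n. x ^ (n - j) * y ^ (j - 1)) - of_nat n * x ^ (n - 1) \<in> A"
proof -
  have "x ^ (n - j) * y ^ (j - 1) - x ^ (n - 1) \<in> A" if "j \<in> {1..n}" for j
  proof -
    have "y ^ (j - 1) - x ^ (j - 1) = - (\<Sum>i<j - 1. x ^ (j - 1 - Suc i) * y ^ i) * (x - y)"
      unfolding power_diff_sumr2 by (simp add: algebra_simps)
    then have "y ^ (j - 1) - x ^ (j - 1) \<in> A" by (simp only: idl.subspace_scale[OF A xy])
    then have "x ^ (n - j) * (y ^ (j - 1) - x ^ (j - 1)) \<in> A" by (rule idl.subspace_scale[OF A])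
    moreover have "x ^ (n - j) * x ^ (j - 1) = x ^ (n - 1)"
      using that by (simp flip: power_add)
    ultimately show ?thesis by (simp add: right_diff_distrib)
  qed
  then have "(\<Sum>j = 1..n. x ^ (n - j) * y ^ (j - 1) - x ^ (n - 1)) \<in> A"
    by (rule idl.subspace_sum[OF A])
  then show ?thesis by (simp add: sum_subtractf)
qed


section \<open>Torsion-free quotients of rank at most \<open>N\<close> over a subring\<close>

text \<open>Gaussian elimination without division, so that the coefficients stay in the subring
  \<open>T\<close>; \<open>K\<close> indexes the vectors and \<open>E\<close> their
  coordinates.\<close>

lemma linear_dependence:
  fixes p :: "'k \<Rightarrow> 'e \<Rightarrow> 'a::idom"
  assumes T: "1 \<in> T" "\<And>x y. x \<in> T \<Longrightarrow> y \<in> T \<Longrightarrow> x + y \<in> T" "\<And>x y. x \<in> T \<Longrightarrow> y \<in> T \<Longrightarrow> x * y \<in> T"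
      "\<And>x. x \<in> T \<Longrightarrow> - x \<in> T"
    and "finite E" and "finite K" and "card E < card K" and "\<And>k e. k \<in> K \<Longrightarrow> e \<in> E \<Longrightarrow> p k e \<in> T"
  shows "\<exists>q. (\<forall>k\<in>K. q k \<in> T) \<and> (\<exists>k\<in>K. q k \<noteq> 0) \<and> (\<forall>e\<in>E. (\<Sum>k\<in>K. q k * p k e) = 0)"
  using assms(5-8)
proof (induction E arbitrary: K p)
  case empty
  then have "\<exists>k. k \<in> K" by (metis card_gt_0_iff card.empty ex_in_conv)
  then show ?case using T(1) by (intro exI[of _ "\<lambda>_. 1"]) auto
next
  case (insert e E)
  have T0: "0 \<in> T" using T(1) T(2)[of 1 "- 1"] T(4)[of 1] by simp
  show ?case
  proof (cases "\<forall>k\<in>K. p k e = 0")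
    case True
    have "card E < card K" using insert by simp
    then obtain q where "\<forall>k\<in>K. q k \<in> T" "\<exists>k\<in>K. q k \<noteq> 0" "\<forall>e\<in>E. (\<Sum>k\<in>K. q k * p k e) = 0"
      using insert.IH[of K p] insert.prems by auto
    then show ?thesis using True by (intro exI[of _ q]) auto
  next
    case False
    then obtain l where l: "l \<in> K" "p l e \<noteq> 0" by blast
    \<comment> \<open>Cross-multiplication with the pivot row \<open>l\<close> clears coordinate
      \<open>e\<close> from all other rows.\<close>
    define p' where "p' k i = p l e * p k i - p k e * p l i" for k i
    have p'T: "p' k i \<in> T" if "k \<in> K" "i \<in> E" for k i
      using T(2)[of "p l e * p k i" "- (p k e * p l i)"] T(3,4) insert.prems(3) l(1) that
      by (simp add: p'_def)
    have "card E < card (K - {l})" using insert l by simp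
    then obtain q where q: "\<forall>k\<in>K - {l}. q k \<in> T" "\<exists>k\<in>K - {l}. q k \<noteq> 0"
        "\<forall>i\<in>E. (\<Sum>k\<in>K - {l}. q k * p' k i) = 0"
      using insert.IH[of "K - {l}" p'] insert.prems p'T by auto
    \<comment> \<open>With these coefficients the combination of the old rows equals the one of the
      rows \<open>p'\<close>, also at \<open>e\<close>, where \<open>p'\<close> vanishes.\<close>
    define r where "r k = (if k = l then - (\<Sum>j\<in>K - {l}. q j * p j e) else q k * p l e)" for k
    have "(\<Sum>j\<in>K - {l}. q j * p j e) \<in> T"
    proof -
      have "(\<Sum>j\<in>F. q j * p j e) \<in> T" if "F \<subseteq> K - {l}" for F
        using finite_subset[OF that finite_Diff[OF insert.prems(1)]] that
        by (induction F) (use T0 T q(1) insert.prems(3) in auto)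
      then show ?thesis by blast
    qed
    then have rT: "\<forall>k\<in>K. r k \<in> T" using T q(1) l insert.prems(3) by (auto simp: r_def)
    moreover have "\<exists>k\<in>K. r k \<noteq> 0" using q(2) l by (auto simp: r_def)
    moreover have "(\<Sum>k\<in>K. r k * p k i) = 0" if "i \<in> insert e E" for i
    proof -
      have "(\<Sum>k\<in>K. r k * p k i) = r l * p l i + (\<Sum>k\<in>K - {l}. r k * p k i)"
        using sum.remove[OF insert.prems(1) l(1)] by blast
      also have "(\<Sum>k\<in>K - {l}. r k * p k i) = (\<Sum>k\<in>K - {l}. q k * p l e * p k i)"
        by (intro sum.cong) (auto simp: r_def)
      also have "r l * p l i + \<dots> = (\<Sum>k\<in>K - {l}. q k * p' k i)"
      proof -
        have "(\<Sum>k\<in>K - {l}. q k * p' k i) =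
            (\<Sum>k\<in>K - {l}. q k * p l e * p k i) - (\<Sum>k\<in>K - {l}. q k * p k e * p l i)"
          by (simp add: p'_def right_diff_distrib mult.assoc sum_subtractf)
        also have "(\<Sum>k\<in>K - {l}. q k * p k e * p l i) = (\<Sum>k\<in>K - {l}. q k * p k e) * p l i"
          by (rule sum_distrib_right[symmetric])
        finally show ?thesis by (simp add: r_def)
      qed
      also have "\<dots> = 0" using that q(3) by (auto simp: p'_def algebra_simps)
      finally show ?thesis .
    qed
    ultimately show ?thesis by blast
  qed
qed

text \<open>\<open>dependent_mod_J\<close> bounds the rank over \<open>T\<close> of the quotient by
  \<open>J\<close>. This weak finiteness takes the place of a noetherian hypothesis.\<close>

locale finite_rank =
  fixes T J :: "'a::idom set" and N :: nat
  assumes T_one: "1 \<in> T" and T_mult: "x \<in> T \<Longrightarrow> y \<in> T \<Longrightarrow> x * y \<in> T"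
    and subspace_J: "idl.subspace J"
    and dependent_mod_J: "\<exists>q. (\<forall>k\<le>N. q k \<in> T) \<and> (\<exists>k\<le>N. q k \<noteq> 0) \<and> (\<Sum>k\<le>N. q k * w k) \<in> J"
begin

text \<open>These are the ideals above \<open>J\<close> whose quotient is torsion-free over
  \<open>T\<close>; the decomposition theory is carried out inside this class.\<close>

definition pure :: "'a set \<Rightarrow> bool" where
  "pure A \<longleftrightarrow> idl.subspace A \<and> J \<subseteq> A \<and> (\<forall>q\<in>T. \<forall>u. q \<noteq> 0 \<longrightarrow> q * u \<in> A \<longrightarrow> u \<in> A)"

lemma T_power: "q \<in> T \<Longrightarrow> q ^ n \<in> T"
  by (induction n) (auto simp: T_one T_mult)

lemma pureD: "pure A \<Longrightarrow> q * u \<in> A \<Longrightarrow> q \<in> T \<Longrightarrow> q \<noteq> 0 \<Longrightarrow> u \<in> A"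
  by (auto simp: pure_def)

lemma pure_subspace: "pure A \<Longrightarrow> idl.subspace A"
  by (auto simp: pure_def)

lemma pure_Int: "pure A \<Longrightarrow> pure B \<Longrightarrow> pure (A \<inter> B)"
  by (auto simp: pure_def intro: idl.subspace_inter)

lemma pure_colon: "pure A \<Longrightarrow> pure {x. x * h \<in> A}"
  unfolding pure_def
proof (intro conjI ballI allI impI)
  assume A: "idl.subspace A \<and> J \<subseteq> A \<and> (\<forall>q\<in>T. \<forall>u. q \<noteq> 0 \<longrightarrow> q * u \<in> A \<longrightarrow> u \<in> A)"
  show "idl.subspace {x. x * h \<in> A}"
    using A by (intro idl.subspaceI)
      (auto simp: idl.subspace_0 distrib_right mult.assoc intro: idl.subspace_add idl.subspace_scale)
  show "J \<subseteq> {x. x * h \<in> A}"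
    using A idl.subspace_scale[of J _ h] subspace_J by (auto simp: mult.commute)
  show "u \<in> {x. x * h \<in> A}" if "q \<in> T" "q \<noteq> 0" "q * u \<in> {x. x * h \<in> A}" for q u
    using A that by (auto simp: mult.assoc)
qed

text \<open>Ascending chain condition by rank: from a strict chain pick one new element at each
  stage. In a relation among the first \<open>N + 1\<close> of them, the last nonzero coefficient
  \<open>q m\<close> gives \<open>q m * v m \<in> f m\<close>, and torsion-freeness puts
  \<open>v m\<close> into \<open>f m\<close> already. The pairs are oriented so that induction may
  assume the claim for larger ideals.\<close>

lemma wf_pure: "wf {(B, A). pure A \<and> pure B \<and> A \<subset> B}"
  unfolding wf_iff_no_infinite_down_chain
proof
  assume "\<exists>f. \<forall>i. (f (Suc i), f i) \<in> {(B, A). pure A \<and> pure B \<and> A \<subset> B}"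
  then obtain f where "\<forall>i. pure (f i) \<and> pure (f (Suc i)) \<and> f i \<subset> f (Suc i)" by auto
  then have f: "\<And>i. pure (f i)" "\<And>i. f i \<subset> f (Suc i)" by blast+
  then have "\<forall>i. \<exists>v. v \<in> f (Suc i) - f i" by blast
  then obtain v where v: "\<And>i. v i \<in> f (Suc i)" "\<And>i. v i \<notin> f i" by (metis DiffE)
  have mono: "f i \<subseteq> f j" if "i \<le> j" for i j
    using lift_Suc_mono_le[of f] f(2) that by blast
  obtain q where q: "\<forall>k\<le>N. q k \<in> T" "\<exists>k\<le>N. q k \<noteq> 0" "(\<Sum>k\<le>N. q k * v k) \<in> J"
    using dependent_mod_J by blast
  define m where "m = Max {k. k \<le> N \<and> q k \<noteq> 0}"
  have "m \<in> {k. k \<le> N \<and> q k \<noteq> 0}" unfolding m_def using q(2) by (intro Max_in) auto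
  then have m: "m \<le> N" "q m \<noteq> 0" by auto
  have gt: "q k = 0" if "m < k" "k \<le> N" for k
  proof (rule ccontr)
    assume "q k \<noteq> 0"
    then have "k \<le> m" unfolding m_def using that by (intro Max_ge) auto
    then show False using that by simp
  qed
  have sub: "idl.subspace (f m)" using f(1) pure_subspace by blast
  have "(\<Sum>k\<le>N. q k * v k) = q m * v m + (\<Sum>k\<in>{..N} - {m}. q k * v k)"
    using m by (intro sum.remove) auto
  moreover have "(\<Sum>k\<in>{..N} - {m}. q k * v k) \<in> f m"
  proof (intro idl.subspace_sum[OF sub])
    fix k assume k: "k \<in> {..N} - {m}"
    show "q k * v k \<in> f m"
    proof (cases "k < m")
      case True
      then have "v k \<in> f m" using v(1)[of k] mono[of "Suc k" m] by auto
      then show ?thesis by (rule idl.subspace_scale[OF sub])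
    qed (use gt k idl.subspace_0[OF sub] in auto)
  qed
  moreover have "(\<Sum>k\<le>N. q k * v k) \<in> f m" using q(3) f(1) by (auto simp: pure_def)
  ultimately have "q m * v m \<in> f m"
    using idl.subspace_diff[OF sub, of "\<Sum>k\<le>N. q k * v k"] add_diff_cancel_right' by metis
  then show False using pureD[OF f(1)] q(1) m v(2) by blast
qed

text \<open>The sum of a pure ideal and a principal ideal need not be pure; this closure repairs
  it.\<close>

lemma pure_saturation:
  assumes B: "idl.subspace B" "J \<subseteq> B"
  shows "pure {z. \<exists>q\<in>T. q \<noteq> 0 \<and> q * z \<in> B}"
  unfolding pure_def
proof (intro conjI ballI allI impI)
  show "idl.subspace {z. \<exists>q\<in>T. q \<noteq> 0 \<and> q * z \<in> B}"
  proof (rule idl.subspaceI)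
    show "0 \<in> {z. \<exists>q\<in>T. q \<noteq> 0 \<and> q * z \<in> B}"
      using T_one idl.subspace_0[OF B(1)] by (auto intro!: bexI[of _ 1])
    fix x y assume "x \<in> {z. \<exists>q\<in>T. q \<noteq> 0 \<and> q * z \<in> B}" "y \<in> {z. \<exists>q\<in>T. q \<noteq> 0 \<and> q * z \<in> B}"
    then obtain p q where "p \<in> T" "p \<noteq> 0" "p * x \<in> B" "q \<in> T" "q \<noteq> 0" "q * y \<in> B" by blast
    moreover have "(p * q) * (x + y) = q * (p * x) + p * (q * y)" by (simp add: algebra_simps)
    ultimately show "x + y \<in> {z. \<exists>q\<in>T. q \<noteq> 0 \<and> q * z \<in> B}"
      using idl.subspace_add[OF B(1)] idl.subspace_scale[OF B(1)] T_mult[of p q]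
      by (auto intro!: bexI[of _ "p * q"])
  next
    fix c x assume "x \<in> {z. \<exists>q\<in>T. q \<noteq> 0 \<and> q * z \<in> B}"
    then obtain q where "q \<in> T" "q \<noteq> 0" "q * x \<in> B" by blast
    then show "c * x \<in> {z. \<exists>q\<in>T. q \<noteq> 0 \<and> q * z \<in> B}"
      using idl.subspace_scale[OF B(1), of "q * x" c] by (auto simp: mult.left_commute)
  qed
  show "J \<subseteq> {z. \<exists>q\<in>T. q \<noteq> 0 \<and> q * z \<in> B}" using B(2) T_one by (auto intro!: bexI[of _ 1])
  fix q u assume q: "q \<in> T" "q \<noteq> 0" and "q * u \<in> {z. \<exists>q\<in>T. q \<noteq> 0 \<and> q * z \<in> B}"
  then obtain p where "p \<in> T" "p \<noteq> 0" "p * (q * u) \<in> B" by blast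
  then show "u \<in> {z. \<exists>q\<in>T. q \<noteq> 0 \<and> q * z \<in> B}"
    using q T_mult[of p q] by (auto simp: mult.assoc intro!: bexI[of _ "p * q"])
qed

text \<open>The classical argument that irreducible ideals of a noetherian ring are primary, run
  inside the pure ideals: the colon ideals by powers of \<open>y\<close> stabilize, and
  \<open>A\<close> is the intersection of the stable one with the closure of
  \<open>A + (y ^ n)\<close>.\<close>

lemma pure_split:
  assumes A: "pure A" and xy: "x * y \<in> A" "x \<notin> A" "\<And>n. y ^ n \<notin> A"
  shows "\<exists>B C. pure B \<and> pure C \<and> A \<subset> B \<and> A \<subset> C \<and> A = B \<inter> C"
proof -
  have sub: "idl.subspace A" using A pure_subspace by blast
  define F where "F n = {z. z * y ^ n \<in> A}" for n
  have pF: "pure (F n)" for n unfolding F_def by (rule pure_colon[OF A])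
  have "F 1 \<in> F ` {1..}" by blast
  \<comment> \<open>Well-foundedness yields a maximal \<open>F n\<close>; the bound on
    \<open>n\<close> ensures that \<open>x\<close> lies in it.\<close>
  then obtain n where n: "n \<ge> 1" and max: "\<And>m. m \<ge> 1 \<Longrightarrow> \<not> F n \<subset> F m"
    using wf_pure pF unfolding wf_eq_minimal by (smt (verit) atLeast_iff case_prodI image_iff mem_Collect_eq)
  have "F n \<subseteq> F (n + n)"
  proof
    fix z assume "z \<in> F n"
    then have "y ^ n * (z * y ^ n) \<in> A" unfolding F_def by (auto intro: idl.subspace_scale[OF sub])
    then show "z \<in> F (n + n)" by (simp add: F_def power_add mult_ac)
  qed
  then have eq: "F (n + n) = F n" using max[of "n + n"] n by auto
  define B where "B = {a + r * y ^ n | a r. a \<in> A}"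
  define C where "C = {z. \<exists>q\<in>T. q \<noteq> 0 \<and> q * z \<in> B}"
  have subB: "idl.subspace B"
  proof (rule idl.subspaceI)
    show "0 \<in> B" unfolding B_def using idl.subspace_0[OF sub] by (auto intro!: exI[of _ 0])
    fix c u v assume "u \<in> B" "v \<in> B"
    then obtain a r a' r' where *: "u = a + r * y ^ n" "v = a' + r' * y ^ n" "a \<in> A" "a' \<in> A"
      unfolding B_def by blast
    have "u + v = (a + a') + (r + r') * y ^ n" "c * u = c * a + (c * r) * y ^ n"
      using * by (simp_all add: algebra_simps)
    then show "u + v \<in> B" "c * u \<in> B"
      unfolding B_def using * idl.subspace_add[OF sub] idl.subspace_scale[OF sub] by blast+
  qed
  have AB: "A \<subseteq> B"
  proof
    fix a assume "a \<in> A"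
    moreover have "a = a + 0 * y ^ n" by simp
    ultimately show "a \<in> B" unfolding B_def by blast
  qed
  have "y ^ n = 0 + 1 * y ^ n" by simp
  then have yB: "y ^ n \<in> B" unfolding B_def using idl.subspace_0[OF sub] by blast
  have BC: "B \<subseteq> C" unfolding C_def using T_one by (auto intro!: bexI[of _ 1])
  have "pure C" unfolding C_def using subB AB A by (intro pure_saturation) (auto simp: pure_def)
  moreover have "A \<subseteq> F n"
    unfolding F_def using idl.subspace_scale[OF sub, of _ "y ^ n"] by (auto simp: mult.commute)
  moreover have "x \<in> F n"
    using n idl.subspace_scale[OF sub xy(1), of "y ^ (n - 1)"]
    by (cases n) (auto simp: F_def algebra_simps)
  moreover have "F n \<inter> C \<subseteq> A"
  proof
    fix z assume "z \<in> F n \<inter> C"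
    then obtain q a r where z: "z * y ^ n \<in> A" "q \<in> T" "q \<noteq> 0" "a \<in> A" "q * z = a + r * y ^ n"
      unfolding C_def B_def F_def by blast
    \<comment> \<open>Stability acts here: \<open>r * y ^ (n + n)\<close> in \<open>A\<close>
      already forces \<open>r * y ^ n\<close> into \<open>A\<close>.\<close>
    have "r * y ^ (n + n) = (q * z - a) * y ^ n" using z(5) by (simp add: power_add mult.assoc)
    also have "\<dots> = q * (z * y ^ n) - y ^ n * a" by (simp add: algebra_simps)
    also have "\<dots> \<in> A"
      by (intro idl.subspace_diff[OF sub] idl.subspace_scale[OF sub z(1)] idl.subspace_scale[OF sub z(4)])
    finally have "r \<in> F n" using eq by (auto simp: F_def)
    then have "q * z \<in> A" using z idl.subspace_add[OF sub] by (auto simp: F_def)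
    then show "z \<in> A" using pureD[OF A] z by blast
  qed
  moreover have "y ^ n \<in> C" "A \<subseteq> C" using yB BC AB by auto
  ultimately show ?thesis using pF[of n] xy(2,3) by (intro exI[of _ "F n"] exI[of _ C]) blast
qed

text \<open>Induction along \<open>wf_pure\<close>, splitting by \<open>pure_split\<close>; the unit
  ideal is the empty intersection.\<close>

lemma pure_decomposition:
  assumes "pure A"
  shows "\<exists>D. finite D \<and> (\<forall>Q\<in>D. primary_ideal cring_class_ops Q \<and> pure Q) \<and> \<Inter>D = A"
  using wf_pure assms
proof (induction A rule: wf_induct_rule)
  case (less A)
  consider "1 \<in> A" | "primary_ideal cring_class_ops A"
    | x y where "x * y \<in> A" "x \<notin> A" "\<And>n. y ^ n \<notin> A"
    using pure_subspace[OF less.prems] by (auto simp: primary_ideal_iff)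
  then show ?case
  proof cases
    case 1
    then have "A = UNIV" using subspace_eq_UNIV_iff pure_subspace[OF less.prems] by blast
    then show ?thesis by (intro exI[of _ "{}"]) auto
  next
    case 2
    then show ?thesis using less.prems by (intro exI[of _ "{A}"]) auto
  next
    case 3
    then obtain B C where BC: "pure B" "pure C" "A \<subset> B" "A \<subset> C" "A = B \<inter> C"
      using pure_split[OF less.prems] by metis
    obtain D where D: "finite D" "\<forall>Q\<in>D. primary_ideal cring_class_ops Q \<and> pure Q" "\<Inter>D = B"
      using less.IH[of B] BC less.prems by auto
    obtain E where E: "finite E" "\<forall>Q\<in>E. primary_ideal cring_class_ops Q \<and> pure Q" "\<Inter>E = C"
      using less.IH[of C] BC less.prems by auto
    show ?thesis using D E BC(5) by (intro exI[of _ "D \<union> E"]) (auto simp: Inter_Un_distrib)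
  qed
qed

lemma rad_pure_primary_Int_T:
  assumes Q: "pure Q" "primary_ideal cring_class_ops Q" and q: "q \<in> T" "q \<in> rad Q"
  shows "q = 0"
proof (rule ccontr)
  assume "q \<noteq> 0"
  obtain n where "q ^ n * 1 \<in> Q" using q by (auto simp: rad_eq)
  then have "1 \<in> Q" using pureD[OF Q(1)] T_power[OF q(1)] \<open>q \<noteq> 0\<close> by simp
  then show False using Q by (simp add: primary_ideal_iff)
qed

text \<open>Incomparability: modulo the smaller radical every element is algebraic over \<open>T\<close>.\<close>

lemma rad_pure_primary_incomparable:
  assumes Q: "pure Q" "primary_ideal cring_class_ops Q"
    and Q': "pure Q'" "primary_ideal cring_class_ops Q'" and sub: "rad Q' \<subseteq> rad Q"
  shows "rad Q' = rad Q"
proof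
  show "rad Q \<subseteq> rad Q'"
  proof
    fix w assume w: "w \<in> rad Q"
    have P: "primeideal (rad Q) cring_class_ops" and P': "primeideal (rad Q') cring_class_ops"
      using primeideal_rad Q Q' by blast+
    have subP: "idl.subspace (rad Q)" using P by (simp add: primeideal_iff)
    obtain q where q: "\<forall>k\<le>N. q k \<in> T" "\<exists>k\<le>N. q k \<noteq> 0" "(\<Sum>k\<le>N. q k * w ^ k) \<in> J"
      using dependent_mod_J by blast
    \<comment> \<open>With \<open>j\<close> minimal, \<open>w ^ j\<close> factors out of the
      relation, and the remaining factor has the constant term \<open>q j\<close>, a nonzero element
      of \<open>T\<close>.\<close>
    define j where "j = (LEAST k. k \<le> N \<and> q k \<noteq> 0)"
    have j: "j \<le> N" "q j \<noteq> 0" using LeastI_ex[of "\<lambda>k. k \<le> N \<and> q k \<noteq> 0"] q(2) by (auto simp: j_def)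
    have below: "q k = 0" if "k < j" for k using not_less_Least[OF that[unfolded j_def]] that j by auto
    define r where "r = (\<Sum>k\<in>{Suc j..N}. q k * w ^ (k - Suc j))"
    have "(\<Sum>k\<le>N. q k * w ^ k) = (\<Sum>k\<in>{j..N}. q k * w ^ k)"
      using below by (intro sum.mono_neutral_right) auto
    also have "\<dots> = q j * w ^ j + (\<Sum>k\<in>{Suc j..N}. q k * w ^ k)"
      using j by (simp add: sum.atLeast_Suc_atMost)
    also have "(\<Sum>k\<in>{Suc j..N}. q k * w ^ k) = (\<Sum>k\<in>{Suc j..N}. w ^ j * w * (q k * w ^ (k - Suc j)))"
    proof (intro sum.cong refl)
      fix k assume "k \<in> {Suc j..N}"
      then have "w ^ k = w ^ j * w * w ^ (k - Suc j)"
        by (metis atLeastAtMost_iff le_add_diff_inverse power_Suc2 power_add)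
      then show "q k * w ^ k = w ^ j * w * (q k * w ^ (k - Suc j))" by simp
    qed
    also have "q j * w ^ j + \<dots> = w ^ j * (q j + r * w)"
      unfolding r_def sum_distrib_left[symmetric] by (simp add: algebra_simps)
    finally have "w ^ j * (q j + r * w) \<in> rad Q'"
      using q(3) Q'(1) subset_rad by (auto simp: pure_def)
    then consider "w ^ j \<in> rad Q'" | "q j + r * w \<in> rad Q'" using P' by (auto simp: primeideal_iff)
    then show "w \<in> rad Q'"
    proof cases
      case 1
      then show ?thesis using prime_power_mem[OF P'] by blast
    next
      case 2
      then have "q j + r * w - r * w \<in> rad Q"
        using sub w by (intro idl.subspace_diff[OF subP] idl.subspace_scale[OF subP]) auto
      then show ?thesis using rad_pure_primary_Int_T[OF Q] q(1) j by auto
    qed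
  qed
qed (rule sub)

end

section \<open>Monomials\<close>

lemma mpoly_eq_sum_single:
  fixes u :: "'e \<Rightarrow>\<^sub>0 'a::comm_monoid_add"
  shows "u = (\<Sum>e\<in>Poly_Mapping.keys u. Poly_Mapping.single e (Poly_Mapping.lookup u e))"
proof (rule poly_mapping_eqI)
  fix k
  have "(\<Sum>e\<in>Poly_Mapping.keys u. Poly_Mapping.lookup (Poly_Mapping.single e (Poly_Mapping.lookup u e)) k) =
      (\<Sum>e\<in>Poly_Mapping.keys u. if e = k then Poly_Mapping.lookup u k else 0)"
    by (intro sum.cong) (auto simp: lookup_single when_def)
  also have "\<dots> = Poly_Mapping.lookup u k"
    by (simp add: in_keys_iff)
  finally show "Poly_Mapping.lookup u k =
      Poly_Mapping.lookup (\<Sum>e\<in>Poly_Mapping.keys u. Poly_Mapping.single e (Poly_Mapping.lookup u e)) k"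
    by (simp add: lookup_sum)
qed

lemma mpoly_induct [case_names single add]:
  fixes u :: "'e \<Rightarrow>\<^sub>0 'a::comm_monoid_add"
  assumes "\<And>e a. P (Poly_Mapping.single e a)" and "\<And>u v. P u \<Longrightarrow> P v \<Longrightarrow> P (u + v)"
  shows "P u"
proof -
  have "P (\<Sum>e\<in>F. Poly_Mapping.single e (Poly_Mapping.lookup u e))" if "finite F" for F
    using that
  proof (induction F)
    case empty
    then show ?case using assms(1)[of undefined 0] by simp
  qed (simp add: assms)
  from this[of "Poly_Mapping.keys u"] mpoly_eq_sum_single[of u] show ?thesis by simp
qed

lemma lookup_single_mult:
  fixes u :: "('n, 'k::comm_ring_1) mpoly"
  shows "Poly_Mapping.lookup (Poly_Mapping.single c a * u) (c + e) = a * Poly_Mapping.lookup u e"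
  by (induction u rule: mpoly_induct)
    (simp_all add: mult_single lookup_single lookup_add distrib_left when_def)

lemma lookup_Abs_exponent [simp]: "Poly_Mapping.lookup (Abs_poly_mapping c) = (c :: 'n::finite \<Rightarrow> nat)"
  by (simp add: Abs_poly_mapping_inverse)

lemma var_power: "var i ^ n = Poly_Mapping.single (Poly_Mapping.single i n) 1"
  by (induction n) (simp_all add: var_def mult_single single_one flip: single_add)

lemma monomial_eq:
  "monomial c = (Poly_Mapping.single (Abs_poly_mapping c) 1 :: ('n::finite, 'k::comm_ring_1) mpoly)"
proof -
  have "(\<Prod>i\<in>A. var i ^ c i) =
      (Poly_Mapping.single (\<Sum>i\<in>A. Poly_Mapping.single i (c i)) 1 :: ('n, 'k) mpoly)" if "finite A" for A
    using that by (induction A) (simp_all add: var_power mult_single single_one)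
  moreover have "(\<Sum>i\<in>UNIV. Poly_Mapping.single i (c i)) = Abs_poly_mapping c"
    by (rule poly_mapping_eqI) (simp add: lookup_sum lookup_single when_def)
  ultimately show ?thesis by (simp add: monomial_def)
qed

lemma single_eq_monomial: "Poly_Mapping.single e 1 = monomial (Poly_Mapping.lookup e)"
  by (simp add: monomial_eq Poly_Mapping.lookup_inverse)

lemma monomial_mult: "monomial c * monomial c' = monomial (\<lambda>i. c i + c' i)"
  by (simp add: monomial_def prod.distrib power_add)

lemma monomial_power: "monomial c ^ n = monomial (\<lambda>i. n * c i)"
  unfolding monomial_def prod_power_distrib
  by (intro prod.cong refl) (simp add: mult.commute flip: power_mult)

lemma var_power_eq_monomial:
  "var i ^ n = (monomial (\<lambda>j. if j = i then n else 0) :: ('n::finite, 'k::comm_ring_1) mpoly)"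
proof -
  have "monomial (\<lambda>j. if j = i then n else 0) =
      (\<Prod>j\<in>UNIV. if j = i then var i ^ n else 1 :: ('n, 'k) mpoly)"
    unfolding monomial_def by (intro prod.cong) auto
  then show ?thesis by simp
qed

lemma prod_var_power_eq_monomial:
  "(\<Prod>j\<in>UNIV - {i}. var j ^ c j) =
    (monomial (\<lambda>j. if j = i then 0 else c j) :: ('n::finite, 'k::comm_ring_1) mpoly)"
proof -
  have "monomial (\<lambda>j. if j = i then 0 else c j) =
      (\<Prod>j\<in>UNIV - {i}. var j ^ (if j = i then 0 else c j) :: ('n, 'k) mpoly)"
    unfolding monomial_def by (intro prod.mono_neutral_right) auto
  also have "\<dots> = (\<Prod>j\<in>UNIV - {i}. var j ^ c j)" by (intro prod.cong) auto
  finally show ?thesis by (rule sym)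
qed

lemma monomial_nonzero: "monomial c \<noteq> (0 :: ('n::finite, 'k::field) mpoly)"
proof
  assume "monomial c = (0 :: ('n, 'k) mpoly)"
  then have "Poly_Mapping.lookup (monomial c :: ('n, 'k) mpoly) (Abs_poly_mapping c) = 0" by simp
  then show False by (simp add: monomial_eq)
qed

section \<open>The constant coefficient, and ideals generated by powers of variables\<close>

definition constant_coeff :: "('n, 'k::comm_ring_1) mpoly \<Rightarrow> 'k" where
  "constant_coeff u = Poly_Mapping.lookup u 0"

lemma constant_coeff_add: "constant_coeff (u + v) = constant_coeff u + constant_coeff v"
  by (simp add: constant_coeff_def lookup_add)

lemma constant_coeff_minus: "constant_coeff (u - v) = constant_coeff u - constant_coeff v"
  by (simp add: constant_coeff_def lookup_minus)

lemma constant_coeff_single_mult: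
  fixes u :: "('n, 'k::comm_ring_1) mpoly"
  shows "constant_coeff (Poly_Mapping.single c a * u) = (if c = 0 then a * constant_coeff u else 0)"
proof (induction u rule: mpoly_induct)
  case (single e a')
  have "c + e = 0 \<longleftrightarrow> c = 0 \<and> e = 0"
    by (metis (mono_tags, lifting) add_is_0 lookup_add lookup_zero poly_mapping_eqI add_0)
  then show ?case by (auto simp: constant_coeff_def mult_single lookup_single when_def)
next
  case (add u v)
  then show ?case by (simp add: constant_coeff_add distrib_left)
qed

lemma constant_coeff_mult:
  fixes u v :: "('n, 'k::comm_ring_1) mpoly"
  shows "constant_coeff (u * v) = constant_coeff u * constant_coeff v"
proof (induction u rule: mpoly_induct)
  case (single e a)
  then show ?case unfolding constant_coeff_single_mult
    by (simp add: constant_coeff_def lookup_single when_def)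
qed (simp add: constant_coeff_add distrib_right)

lemma constant_coeff_one [simp]: "constant_coeff 1 = 1"
  by (simp add: constant_coeff_def)

lemma subspace_constant_coeff:
  "idl.subspace {u :: ('n, 'k::comm_ring_1) mpoly. constant_coeff u = 0}"
  by (intro idl.subspaceI) (auto simp: constant_coeff_add constant_coeff_mult, simp add: constant_coeff_def)

lemma span_image_finite:
  fixes x :: "'i \<Rightarrow> 'a::comm_ring_1"
  assumes "finite A"
  shows "u \<in> idl.span (x ` A) \<longleftrightarrow> (\<exists>k. u = (\<Sum>j\<in>A. k j * x j))"
proof
  have "idl.span (x ` A) \<subseteq> {u. \<exists>k. u = (\<Sum>j\<in>A. k j * x j)}"
  proof (rule idl.span_minimal)
    show "x ` A \<subseteq> {u. \<exists>k. u = (\<Sum>j\<in>A. k j * x j)}"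
    proof clarify
      fix i assume "i \<in> A"
      then have "x i = (\<Sum>j\<in>A. (if j = i then 1 else 0) * x j)"
        using assms by (simp add: if_distrib[of "\<lambda>c. c * _"] cong: if_cong)
      then show "\<exists>k. x i = (\<Sum>j\<in>A. k j * x j)" by (rule exI[of _ "\<lambda>j. if j = i then 1 else 0"])
    qed
    show "idl.subspace {u. \<exists>k. u = (\<Sum>j\<in>A. k j * x j)}"
    proof (rule idl.subspaceI)
      show "0 \<in> {u. \<exists>k. u = (\<Sum>j\<in>A. k j * x j)}" by (auto intro: exI[of _ "\<lambda>_. 0"])
      fix u v c assume "u \<in> {u. \<exists>k. u = (\<Sum>j\<in>A. k j * x j)}" "v \<in> {u. \<exists>k. u = (\<Sum>j\<in>A. k j * x j)}"
      then obtain k l where "u = (\<Sum>j\<in>A. k j * x j)" "v = (\<Sum>j\<in>A. l j * x j)" by blast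
      then have "u + v = (\<Sum>j\<in>A. (k j + l j) * x j)" "c * u = (\<Sum>j\<in>A. (c * k j) * x j)"
        by (simp_all add: distrib_right sum.distrib sum_distrib_left mult.assoc)
      then show "u + v \<in> {u. \<exists>k. u = (\<Sum>j\<in>A. k j * x j)}" "c * u \<in> {u. \<exists>k. u = (\<Sum>j\<in>A. k j * x j)}"
        by (simp_all only: mem_Collect_eq)
          (rule exI[of _ "\<lambda>j. k j + l j"] exI[of _ "\<lambda>j. c * k j"], rule refl)+
    qed
  qed
  then show "u \<in> idl.span (x ` A) \<Longrightarrow> \<exists>k. u = (\<Sum>j\<in>A. k j * x j)" by blast
next
  show "\<exists>k. u = (\<Sum>j\<in>A. k j * x j) \<Longrightarrow> u \<in> idl.span (x ` A)"
    by (elim exE, simp only:) (intro idl.span_sum idl.span_scale idl.span_base imageI)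
qed

text \<open>In a monomial ideal membership is decided term by term, so cancellation can be read off
  from exponents.\<close>

lemma span_var_powers:
  fixes a :: "'n \<Rightarrow> nat"
  shows "idl.span ((\<lambda>j. var j ^ a j) ` A) =
    {u :: ('n, 'k::comm_ring_1) mpoly. \<forall>e\<in>Poly_Mapping.keys u. \<exists>j\<in>A. a j \<le> Poly_Mapping.lookup e j}"
    (is "_ = ?M")
proof
  have "idl.subspace ?M"
  proof (rule idl.subspaceI)
    show "u + v \<in> ?M" if "u \<in> ?M" "v \<in> ?M" for u v
      using that Poly_Mapping.keys_add[of u v] by blast
    show "c * u \<in> ?M" if "u \<in> ?M" for c u
    proof clarify
      fix e assume "e \<in> Poly_Mapping.keys (c * u)"
      then obtain e1 e2 where e: "e = e1 + e2" "e2 \<in> Poly_Mapping.keys u"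
        using Poly_Mapping.keys_mult[of c u] by blast
      from that have "\<forall>e\<in>Poly_Mapping.keys u. \<exists>j\<in>A. a j \<le> Poly_Mapping.lookup e j"
        by (rule CollectD)
      from bspec[OF this e(2)] obtain j where "j \<in> A" "a j \<le> Poly_Mapping.lookup e2 j" by (elim bexE)
      with e show "\<exists>j\<in>A. a j \<le> Poly_Mapping.lookup e j"
        by (auto simp: lookup_add intro!: bexI[of _ j])
    qed
  qed simp
  moreover have "var j ^ a j \<in> ?M" if "j \<in> A" for j
    using that by (auto simp: var_power intro!: bexI[of _ j])
  ultimately show "idl.span ((\<lambda>j. var j ^ a j) ` A) \<subseteq> ?M"
    by (intro idl.span_minimal) auto
  show "?M \<subseteq> idl.span ((\<lambda>j. var j ^ a j) ` A)"
  proof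
    fix u :: "('n, 'k) mpoly" assume u: "u \<in> ?M"
    have "Poly_Mapping.single e (Poly_Mapping.lookup u e) \<in> idl.span ((\<lambda>j. var j ^ a j) ` A)"
      if "e \<in> Poly_Mapping.keys u" for e
    proof -
      from u have "\<forall>e\<in>Poly_Mapping.keys u. \<exists>j\<in>A. a j \<le> Poly_Mapping.lookup e j"
        by (rule CollectD)
      from bspec[OF this that] obtain j where j: "j \<in> A" "a j \<le> Poly_Mapping.lookup e j" by (elim bexE)
      have "e = (e - Poly_Mapping.single j (a j)) + Poly_Mapping.single j (a j)"
        using j by (intro poly_mapping_eqI) (auto simp: lookup_add lookup_minus lookup_single when_def)
      then have "Poly_Mapping.single e (Poly_Mapping.lookup u e) =
          Poly_Mapping.single (e - Poly_Mapping.single j (a j)) (Poly_Mapping.lookup u e) * var j ^ a j"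
        by (simp add: var_power mult_single)
      then show ?thesis using j by (auto intro: idl.span_scale idl.span_base)
    qed
    then have "(\<Sum>e\<in>Poly_Mapping.keys u. Poly_Mapping.single e (Poly_Mapping.lookup u e)) \<in> idl.span ((\<lambda>j. var j ^ a j) ` A)"
      by (rule idl.span_sum)
    then show "u \<in> idl.span ((\<lambda>j. var j ^ a j) ` A)" using mpoly_eq_sum_single[of u] by simp
  qed
qed

text \<open>Multiplying by a power of \<open>var i\<close> leaves the exponents of the variables in
  \<open>A\<close> alone, and only these decide membership.\<close>

lemma span_var_powers_cancel:
  fixes h :: "('n, 'k::comm_ring_1) mpoly"
  assumes "i \<notin> A" and "h * var i ^ n \<in> idl.span ((\<lambda>j. var j ^ a j) ` A)"
  shows "h \<in> idl.span ((\<lambda>j. var j ^ a j) ` A)"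
  unfolding span_var_powers
proof clarify
  fix e assume "e \<in> Poly_Mapping.keys h"
  then have "Poly_Mapping.single i n + e \<in> Poly_Mapping.keys (h * var i ^ n)"
    by (simp add: in_keys_iff var_power lookup_single_mult mult.commute[of h])
  then obtain j where "j \<in> A" "a j \<le> Poly_Mapping.lookup (Poly_Mapping.single i n + e) j"
    using assms(2) unfolding span_var_powers by blast
  then show "\<exists>j\<in>A. a j \<le> Poly_Mapping.lookup e j"
    using assms(1) by (auto simp: lookup_add lookup_single when_def split: if_splits)
qed

text \<open>Syzygies modulo \<open>t\<^sub>s\<close> of powers of distinct variables are Koszul syzygies, and Koszul syzygies
  lift to relations among the deformed generators \<open>f i\<close>.\<close>

lemma relation_mod_var:
  fixes h f z :: "'n \<Rightarrow> ('n, 'k::comm_ring_1) mpoly"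
  assumes "finite A" and "s \<notin> A" and "\<And>i. i \<in> A \<Longrightarrow> f i = var i ^ a i - var s * z i"
    and "(\<Sum>i\<in>A. h i * var i ^ a i) = var s * r0"
  shows "\<exists>r\<in>idl.span (f ` A). (\<Sum>i\<in>A. h i * f i) = var s * r"
  using assms
proof (induction A arbitrary: h r0)
  case empty
  then show ?case by (auto intro: bexI[of _ 0] idl.span_zero)
next
  case (insert i A)
  \<comment> \<open>\<open>var s\<close> joins the family of variable powers with exponent 1; the
    other exponents are unchanged.\<close>
  define a' where "a' = a(s := 1)"
  have x: "var j ^ a' j = (var j ^ a j :: ('n, 'k) mpoly)" if "j \<in> insert i A" for j
    using that insert.prems(1) by (auto simp: a'_def)
  have xs: "var s ^ a' s = (var s :: ('n, 'k) mpoly)" by (simp add: a'_def)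
  have "h i * var i ^ a i = var s * r0 - (\<Sum>j\<in>A. h j * var j ^ a j)"
    using insert.prems(3) insert.hyps by (simp add: algebra_simps)
  also have "\<dots> = r0 * var s ^ a' s + (\<Sum>j\<in>A. - h j * var j ^ a' j)"
  proof -
    have "(\<Sum>j\<in>A. - h j * var j ^ a' j) = (\<Sum>j\<in>A. - (h j * var j ^ a j))"
      by (intro sum.cong) (simp_all add: x[OF insertI2])
    then show ?thesis unfolding xs by (simp add: sum_negf mult.commute)
  qed
  also have "\<dots> \<in> idl.span ((\<lambda>j. var j ^ a' j) ` insert s A)"
    by (intro idl.span_add idl.span_sum idl.span_scale idl.span_base) auto
  finally have "h i \<in> idl.span ((\<lambda>j. var j ^ a' j) ` insert s A)"
    using span_var_powers_cancel[of i "insert s A" "h i" "a i" a'] insert.hyps insert.prems(1) by auto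
  then obtain k where "h i = (\<Sum>j\<in>insert s A. k j * var j ^ a' j)"
    unfolding span_image_finite[OF finite.insertI[OF insert.hyps(1)]] by blast
  then have hi: "h i = k s * var s + (\<Sum>j\<in>A. k j * var j ^ a j)"
  proof -
    have "(\<Sum>j\<in>A. k j * var j ^ a' j) = (\<Sum>j\<in>A. k j * var j ^ a j)"
      by (intro sum.cong) (simp_all add: x[OF insertI2])
    moreover have "s \<notin> A" using insert.prems(1) by blast
    ultimately show ?thesis
      using \<open>h i = (\<Sum>j\<in>insert s A. k j * var j ^ a' j)\<close> insert.hyps(1) xs by simp
  qed
  \<comment> \<open>Adding the Koszul terms \<open>k j * var i ^ a i\<close> absorbs the summand at
    \<open>i\<close> up to a multiple of \<open>var s\<close>, so that the induction hypothesis
    applies to \<open>A\<close>.\<close>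
  define h' where "h' j = h j + k j * var i ^ a i" for j
  have "(\<Sum>j\<in>A. h' j * var j ^ a j) =
      (\<Sum>j\<in>A. h j * var j ^ a j) + (h i - k s * var s) * var i ^ a i"
    by (simp add: h'_def hi distrib_left distrib_right sum.distrib sum_distrib_left mult_ac)
  also have "\<dots> = var s * (r0 - k s * var i ^ a i)"
    using insert.prems(3) insert.hyps by (simp add: algebra_simps)
  finally obtain r where r: "r \<in> idl.span (f ` A)" "(\<Sum>j\<in>A. h' j * f j) = var s * r"
    using insert.IH[of h' "r0 - k s * var i ^ a i"] insert.prems by auto
  have xf: "var j ^ a j = f j + var s * z j" if "j \<in> insert i A" for j
    using insert.prems(2)[OF that] by simp
  have "h i = k s * var s + (\<Sum>j\<in>A. k j * (f j + var s * z j))"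
    unfolding hi using xf by (intro arg_cong2[where f = plus] sum.cong) auto
  also have "\<dots> = k s * var s + (\<Sum>j\<in>A. k j * f j) + var s * (\<Sum>j\<in>A. k j * z j)"
    by (simp add: distrib_left sum.distrib sum_distrib_left mult_ac)
  finally have hi': "h i = k s * var s + (\<Sum>j\<in>A. k j * f j) + var s * (\<Sum>j\<in>A. k j * z j)" .
  have "(\<Sum>j\<in>A. h j * f j) = (\<Sum>j\<in>A. h' j * f j) - (\<Sum>j\<in>A. k j * f j) * var i ^ a i"
    by (simp add: h'_def distrib_left distrib_right sum.distrib sum_distrib_left mult_ac)
  then have "(\<Sum>j\<in>insert i A. h j * f j) =
      h i * f i + (var s * r - (\<Sum>j\<in>A. k j * f j) * (f i + var s * z i))"
    using insert.hyps r(2) xf[of i] by simp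
  also have "\<dots> = var s * (r + (k s + (\<Sum>j\<in>A. k j * z j)) * f i - z i * (\<Sum>j\<in>A. k j * f j))"
    unfolding hi' by (simp add: algebra_simps)
  finally have "(\<Sum>j\<in>insert i A. h j * f j) =
      var s * (r + (k s + (\<Sum>j\<in>A. k j * z j)) * f i - z i * (\<Sum>j\<in>A. k j * f j))" .
  moreover have "r + (k s + (\<Sum>j\<in>A. k j * z j)) * f i - z i * (\<Sum>j\<in>A. k j * f j) \<in> idl.span (f ` insert i A)"
  proof (intro idl.span_diff idl.span_add)
    show "r \<in> idl.span (f ` insert i A)" using r(1) idl.span_mono[of "f ` A" "f ` insert i A"] by auto
    show "(k s + (\<Sum>j\<in>A. k j * z j)) * f i \<in> idl.span (f ` insert i A)"
      by (intro idl.span_scale idl.span_base) auto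
    show "z i * (\<Sum>j\<in>A. k j * f j) \<in> idl.span (f ` insert i A)"
      by (intro idl.span_scale idl.span_sum idl.span_base) auto
  qed
  ultimately show ?case by blast
qed

text \<open>Modulo \<open>var s\<close> a relation among the \<open>f i\<close> is a syzygy of
  variable powers; \<open>relation_mod_var\<close> writes its value as \<open>var s\<close> times an
  element of the ideal, and \<open>var s\<close> cancels in the polynomial domain.\<close>

lemma var_nonzerodivisor:
  fixes f z :: "'n::linorder \<Rightarrow> ('n, 'k::field) mpoly"
  assumes A: "finite A" "s \<notin> A" and f: "\<And>i. i \<in> A \<Longrightarrow> f i = var i ^ a i - var s * z i"
    and u: "var s * u \<in> idl.span (f ` A)"
  shows "u \<in> idl.span (f ` A)"
proof -
  obtain h where h: "var s * u = (\<Sum>i\<in>A. h i * f i)"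
    using u unfolding span_image_finite[OF A(1)] by blast
  have "(\<Sum>i\<in>A. h i * var i ^ a i) = (\<Sum>i\<in>A. h i * f i + var s * (h i * z i))"
    using f by (intro sum.cong) (auto simp: right_diff_distrib mult_ac)
  also have "\<dots> = var s * (u + (\<Sum>i\<in>A. h i * z i))"
    by (simp add: h distrib_left sum.distrib sum_distrib_left)
  finally obtain r where "r \<in> idl.span (f ` A)" "(\<Sum>i\<in>A. h i * f i) = var s * r"
    using relation_mod_var[OF A f, where h = h] by blast
  then have r: "r \<in> idl.span (f ` A)" "var s * u = var s * r" using h by simp_all
  moreover have "var s \<noteq> (0 :: ('n, 'k) mpoly)"
  proof
    assume "var s = (0 :: ('n, 'k) mpoly)"
    then have "Poly_Mapping.lookup (var s :: ('n, 'k) mpoly) (Poly_Mapping.single s 1) = 0" by simp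
    then show False by (simp add: var_def)
  qed
  ultimately show ?thesis by simp
qed

section \<open>Lattice ideals\<close>

definition exponent :: "('n::finite \<Rightarrow>\<^sub>0 nat) \<Rightarrow> int ^ 'n" where
  "exponent e = (\<chi> i. int (Poly_Mapping.lookup e i))"

lemma exponent_nth [simp]: "exponent e $ i = int (Poly_Mapping.lookup e i)"
  by (simp add: exponent_def)

lemma exponent_add: "exponent (e + e') = exponent e + exponent e'"
  by (simp add: vec_eq_iff lookup_add)

definition lattice_binomial :: "int ^ 'n \<Rightarrow> ('n::finite, 'k::comm_ring_1) mpoly" where
  "lattice_binomial a = monomial (\<lambda>i. nat (a $ i)) - monomial (\<lambda>i. nat (- (a $ i)))"

lemma lattice_ideal_eq_span:
  "lattice_ideal \<L> = idl.span (lattice_binomial ` \<L> :: ('n::finite, 'k::comm_ring_1) mpoly set)"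
  unfolding lattice_ideal_def Idl_eq_span lattice_binomial_def by (rule arg_cong[of _ _ idl.span]) blast

lemma subspace_lattice_ideal: "idl.subspace (lattice_ideal \<L> :: ('n::finite, 'k::comm_ring_1) mpoly set)"
  by (simp add: lattice_ideal_eq_span)

text \<open>Dividing both monomials by their greatest common divisor leaves exponents of disjoint
  support.\<close>

lemma monomial_diff_factor:
  assumes "\<And>i. int (c i) - int (c' i) = a $ i"
  shows "monomial c - monomial c' =
    monomial (\<lambda>i. min (c i) (c' i)) * (lattice_binomial a :: ('n::finite, 'k::comm_ring_1) mpoly)"
proof -
  have "min (c i) (c' i) + nat (a $ i) = c i" "min (c i) (c' i) + nat (- (a $ i)) = c' i" for i
    using assms[of i] by linarith+
  then show ?thesis unfolding lattice_binomial_def right_diff_distrib monomial_mult by simp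
qed

locale int_lattice =
  fixes \<L> :: "(int ^ 'n::{finite,linorder}) set"
  assumes zero_mem: "0 \<in> \<L>" and diff_mem: "a \<in> \<L> \<Longrightarrow> b \<in> \<L> \<Longrightarrow> a - b \<in> \<L>"
begin

lemma uminus_mem: "a \<in> \<L> \<Longrightarrow> - a \<in> \<L>"
  using diff_mem[OF zero_mem] by fastforce

lemma add_mem: "a \<in> \<L> \<Longrightarrow> b \<in> \<L> \<Longrightarrow> a + b \<in> \<L>"
  using diff_mem[of a "- b"] uminus_mem by fastforce

text \<open>The coefficient of the class of \<open>v\<close> in the image of \<open>u\<close> in the group ring of
  the quotient by the lattice.\<close>

definition class_sum :: "('n, 'k::field) mpoly \<Rightarrow> (int, 'n) vec \<Rightarrow> 'k" where
  "class_sum u v = (\<Sum>e\<in>Poly_Mapping.keys u. if exponent e - v \<in> \<L> then Poly_Mapping.lookup u e else 0)"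

lemma class_sum_superset:
  "finite F \<Longrightarrow> Poly_Mapping.keys u \<subseteq> F \<Longrightarrow>
    class_sum u v = (\<Sum>e\<in>F. if exponent e - v \<in> \<L> then Poly_Mapping.lookup u e else 0)"
  unfolding class_sum_def by (intro sum.mono_neutral_left) (auto simp: in_keys_iff)

lemma class_sum_add: "class_sum (u + w) v = class_sum u v + class_sum w v"
proof -
  let ?F = "Poly_Mapping.keys u \<union> Poly_Mapping.keys w"
  have "class_sum (u + w) v = (\<Sum>e\<in>?F. if exponent e - v \<in> \<L> then Poly_Mapping.lookup (u + w) e else 0)"
    using Poly_Mapping.keys_add[of u w] by (intro class_sum_superset) auto
  also have "\<dots> = (\<Sum>e\<in>?F. if exponent e - v \<in> \<L> then Poly_Mapping.lookup u e else 0) +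
      (\<Sum>e\<in>?F. if exponent e - v \<in> \<L> then Poly_Mapping.lookup w e else 0)"
    unfolding sum.distrib[symmetric] by (intro sum.cong) (auto simp: lookup_add)
  also have "\<dots> = class_sum u v + class_sum w v"
    by (simp add: class_sum_superset[of ?F])
  finally show ?thesis .
qed

lemma class_sum_single:
  "class_sum (Poly_Mapping.single e a) v = (if exponent e - v \<in> \<L> then a else 0)"
  by (subst class_sum_superset[of "{e}"]) (auto simp: keys_single)

lemma class_sum_zero [simp]: "class_sum 0 v = 0"
  by (simp add: class_sum_def)

lemma class_sum_single_mult:
  "class_sum (Poly_Mapping.single c a * u) v = a * class_sum u (v - exponent c)"
proof (induction u rule: mpoly_induct)
  case (single e a')
  then show ?case by (simp add: mult_single class_sum_single exponent_add algebra_simps)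
next
  case (add u w)
  then show ?case by (simp add: distrib_left class_sum_add)
qed

lemma class_sum_mult:
  "class_sum (q * u) v =
    (\<Sum>c\<in>Poly_Mapping.keys q. Poly_Mapping.lookup q c * class_sum u (v - exponent c))"
proof -
  have "class_sum ((\<Sum>c\<in>F. Poly_Mapping.single c (Poly_Mapping.lookup q c)) * u) v =
      (\<Sum>c\<in>F. Poly_Mapping.lookup q c * class_sum u (v - exponent c))" if "finite F" for F
    using that
    by (induction F) (simp_all add: distrib_right class_sum_add class_sum_single_mult)
  from this[of "Poly_Mapping.keys q"] mpoly_eq_sum_single[of q] show ?thesis by simp
qed

lemma class_sum_cong:
  assumes "v - w \<in> \<L>"
  shows "class_sum u v = class_sum u w"
proof -
  have "exponent e - v \<in> \<L> \<longleftrightarrow> exponent e - w \<in> \<L>" for e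
    using add_mem[OF _ assms, of "exponent e - v"] diff_mem[OF _ assms, of "exponent e - w"] by auto
  then show ?thesis by (simp add: class_sum_def)
qed

lemma subspace_class_sum: "idl.subspace {u. \<forall>v. class_sum u v = 0}"
  by (intro idl.subspaceI) (auto simp: class_sum_add class_sum_mult)

lemma single_diff_mem_lattice_ideal:
  assumes "exponent e - exponent e' \<in> \<L>"
  shows "Poly_Mapping.single e a - Poly_Mapping.single e' a
    \<in> (lattice_ideal \<L> :: ('n, 'k::field) mpoly set)"
proof -
  have "monomial (Poly_Mapping.lookup e) - monomial (Poly_Mapping.lookup e') =
      monomial (\<lambda>i. min (Poly_Mapping.lookup e i) (Poly_Mapping.lookup e' i)) *
      (lattice_binomial (exponent e - exponent e') :: ('n, 'k) mpoly)"
    by (rule monomial_diff_factor) simp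
  then have "Poly_Mapping.single e 1 - Poly_Mapping.single e' 1 \<in> (lattice_ideal \<L> :: ('n, 'k) mpoly set)"
    unfolding lattice_ideal_eq_span single_eq_monomial
    using assms by (auto intro: idl.span_scale idl.span_base)
  from idl.span_scale[OF this[unfolded lattice_ideal_eq_span], of "Poly_Mapping.single 0 a"]
  show ?thesis by (simp add: lattice_ideal_eq_span right_diff_distrib mult_single)
qed

lemma class_sum_lattice_ideal:
  assumes "u \<in> (lattice_ideal \<L> :: ('n, 'k::field) mpoly set)"
  shows "class_sum u v = 0"
proof -
  have "lattice_binomial a \<in> {u :: ('n, 'k) mpoly. \<forall>v. class_sum u v = 0}" if "a \<in> \<L>" for a
  proof -
    let ?p = "Abs_poly_mapping (\<lambda>i. nat (a $ i))" and ?m = "Abs_poly_mapping (\<lambda>i. nat (- (a $ i)))"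
    have a: "exponent ?p - exponent ?m = a" by (simp add: vec_eq_iff)
    have "class_sum (lattice_binomial a + monomial (\<lambda>i. nat (- (a $ i)))) v =
        (class_sum (monomial (\<lambda>i. nat (- (a $ i)))) v :: 'k)" for v
    proof -
      have "exponent ?p - v \<in> \<L> \<longleftrightarrow> exponent ?m - v \<in> \<L>"
        using a add_mem[OF that, of "exponent ?m - v"] diff_mem[OF _ that, of "exponent ?p - v"]
        by (auto simp: algebra_simps)
      then show ?thesis by (simp add: lattice_binomial_def monomial_eq class_sum_single)
    qed
    then show ?thesis by (simp add: class_sum_add)
  qed
  then have "lattice_ideal \<L> \<subseteq> {u :: ('n, 'k) mpoly. \<forall>v. class_sum u v = 0}"
    unfolding lattice_ideal_eq_span by (intro idl.span_minimal subspace_class_sum) blast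
  then show ?thesis using assms by blast
qed

text \<open>The lattice ideal is the kernel of the map to the group ring of the quotient by the
  lattice. For the harder direction: a term whose class sum vanishes has a partner in its class, and
  subtracting a multiple of their binomial removes the term without creating a new exponent.\<close>

lemma lattice_ideal_iff_class_sum:
  "u \<in> (lattice_ideal \<L> :: ('n, 'k::field) mpoly set) \<longleftrightarrow> (\<forall>v. class_sum u v = 0)"
proof
  show "u \<in> lattice_ideal \<L> \<Longrightarrow> \<forall>v. class_sum u v = 0" using class_sum_lattice_ideal by blast
  have subI: "idl.subspace (lattice_ideal \<L> :: ('n, 'k) mpoly set)"
    by (simp add: lattice_ideal_eq_span)
  show "u \<in> lattice_ideal \<L>" if "\<forall>v. class_sum u v = 0"
    using that
  proof (induction "card (Poly_Mapping.keys u)" arbitrary: u rule: less_induct)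
    case less
    show ?case
    proof (cases "u = 0")
      case False
      then obtain e where e: "e \<in> Poly_Mapping.keys u" by (metis ex_in_conv keys_eq_empty)
      let ?a = "Poly_Mapping.lookup u e"
      have "0 = class_sum u (exponent e)" using less.prems by simp
      also have "\<dots> = ?a + (\<Sum>e'\<in>Poly_Mapping.keys u - {e}.
          if exponent e' - exponent e \<in> \<L> then Poly_Mapping.lookup u e' else 0)"
        unfolding class_sum_def using e zero_mem by (subst sum.remove[of _ e]) auto
      finally have "(\<Sum>e'\<in>Poly_Mapping.keys u - {e}.
          if exponent e' - exponent e \<in> \<L> then Poly_Mapping.lookup u e' else 0) \<noteq> 0"
        using e by (auto simp: in_keys_iff)
      then obtain e' where e': "e' \<in> Poly_Mapping.keys u" "e' \<noteq> e" "exponent e' - exponent e \<in> \<L>"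
        by (smt (verit) DiffE singletonI sum.neutral)
      define w where "w = Poly_Mapping.single e ?a - Poly_Mapping.single e' ?a"
      have w: "w \<in> lattice_ideal \<L>"
        unfolding w_def using uminus_mem[OF e'(3)] by (intro single_diff_mem_lattice_ideal) simp
      have "\<forall>v. class_sum (u - w) v = 0"
        using less.prems class_sum_add[of "u - w" w] class_sum_lattice_ideal[OF w] by simp
      moreover have "Poly_Mapping.keys (u - w) \<subset> Poly_Mapping.keys u"
      proof -
        have "Poly_Mapping.keys (u - w) \<subseteq> Poly_Mapping.keys u"
          using e e' by (auto simp: in_keys_iff lookup_minus w_def lookup_single when_def split: if_splits)
        moreover have "e \<notin> Poly_Mapping.keys (u - w)"
          using e' by (simp add: in_keys_iff lookup_minus w_def lookup_single when_def)
        ultimately show ?thesis using e by blast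
      qed
      ultimately have "u - w \<in> lattice_ideal \<L>"
        by (intro less.hyps) (auto intro: psubset_card_mono)
      then show ?thesis using idl.subspace_add[OF subI _ w, of "u - w"] by simp
    qed (simp add: idl.subspace_0[OF subI])
  qed
qed

text \<open>Multiplication by a monomial only translates the classes.\<close>

lemma lattice_ideal_monomial_cancel:
  assumes "monomial c * u \<in> (lattice_ideal \<L> :: ('n, 'k::field) mpoly set)"
  shows "u \<in> lattice_ideal \<L>"
  unfolding lattice_ideal_iff_class_sum
proof
  fix v
  have "class_sum (monomial c * u) (v + exponent (Abs_poly_mapping c)) = 0"
    using assms by (simp add: lattice_ideal_iff_class_sum)
  then show "class_sum u v = 0" by (simp add: monomial_eq class_sum_single_mult)
qed

end

section \<open>The subring K[t_s] and positive gradings\<close>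

definition univariate :: "'n \<Rightarrow> ('n, 'k::comm_ring_1) mpoly set" where
  "univariate s = {q. \<forall>e\<in>Poly_Mapping.keys q. \<forall>i. i \<noteq> s \<longrightarrow> Poly_Mapping.lookup e i = 0}"

lemma univariate_zero: "0 \<in> univariate s"
  by (simp add: univariate_def)

lemma univariate_one: "1 \<in> univariate s"
  by (simp add: univariate_def)

lemma univariate_add: "p \<in> univariate s \<Longrightarrow> q \<in> univariate s \<Longrightarrow> p + q \<in> univariate s"
  unfolding univariate_def using Poly_Mapping.keys_add[of p q] by blast

lemma univariate_uminus: "p \<in> univariate s \<Longrightarrow> - p \<in> univariate s"
  by (simp add: univariate_def in_keys_iff)

lemma univariate_mult: "p \<in> univariate s \<Longrightarrow> q \<in> univariate s \<Longrightarrow> p * q \<in> univariate s"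
  unfolding univariate_def
proof clarify
  fix e i
  assume p: "\<forall>e\<in>Poly_Mapping.keys p. \<forall>i. i \<noteq> s \<longrightarrow> Poly_Mapping.lookup e i = 0"
    and q: "\<forall>e\<in>Poly_Mapping.keys q. \<forall>i. i \<noteq> s \<longrightarrow> Poly_Mapping.lookup e i = 0"
    and e: "e \<in> Poly_Mapping.keys (p * q)" and i: "i \<noteq> s"
  obtain e1 e2 where "e = e1 + e2" "e1 \<in> Poly_Mapping.keys p" "e2 \<in> Poly_Mapping.keys q"
    using Poly_Mapping.keys_mult[of p q] e by blast
  then show "Poly_Mapping.lookup e i = 0" using p q i by (simp add: lookup_add)
qed

lemma univariate_monomial: "(\<And>i. i \<noteq> s \<Longrightarrow> c i = 0) \<Longrightarrow> monomial c \<in> univariate s"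
  by (simp add: univariate_def monomial_eq)

text \<open>The lattice lies in the hyperplane with the positive normal \<open>d\<close>, so its
  ideal is homogeneous for the weights \<open>d\<close>.\<close>

locale homogeneous_lattice = int_lattice \<L> for \<L> :: "(int ^ 'n::{finite,linorder}) set" +
  fixes d :: "'n \<Rightarrow> real"
  assumes d_pos: "0 < d i" and homogeneous: "a \<in> \<L> \<Longrightarrow> (\<Sum>i\<in>UNIV. d i * real_of_int (a $ i)) = 0"
begin

definition wdeg :: "(int, 'n) vec \<Rightarrow> real" where
  "wdeg v = (\<Sum>i\<in>UNIV. d i * real_of_int (v $ i))"

lemma wdeg_add: "wdeg (v + w) = wdeg v + wdeg w"
  by (simp add: wdeg_def distrib_left sum.distrib)

lemma wdeg_diff: "wdeg (v - w) = wdeg v - wdeg w"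
  by (simp add: wdeg_def right_diff_distrib sum_subtractf)

lemma wdeg_cong: "v - w \<in> \<L> \<Longrightarrow> wdeg v = wdeg w"
  using homogeneous[of "v - w"] wdeg_diff[of v w] by (simp add: wdeg_def)

lemma wdeg_univariate:
  assumes "\<forall>i. i \<noteq> s \<longrightarrow> Poly_Mapping.lookup e i = 0"
  shows "wdeg (exponent e) = d s * real (Poly_Mapping.lookup e s)"
proof -
  have "wdeg (exponent e) = (\<Sum>i\<in>{s}. d i * real_of_int (exponent e $ i))"
    unfolding wdeg_def using assms by (intro sum.mono_neutral_right) auto
  then show ?thesis by simp
qed

text \<open>In the product \<open>q * u\<close> the parts of lowest degree of \<open>q\<close> and \<open>u\<close> cannot cancel.\<close>

lemma lattice_ideal_torsion_free:
  assumes q: "q \<in> univariate s" "q \<noteq> 0" and qu: "q * u \<in> (lattice_ideal \<L> :: ('n, 'k::field) mpoly set)"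
  shows "u \<in> lattice_ideal \<L>"
proof (rule ccontr)
  assume "u \<notin> lattice_ideal \<L>"
  then obtain v where v: "class_sum u v \<noteq> 0" by (auto simp: lattice_ideal_iff_class_sum)
  have rep: "\<exists>e\<in>Poly_Mapping.keys u. exponent e - w \<in> \<L>" if "class_sum u w \<noteq> 0" for w
    using that unfolding class_sum_def by (smt (verit) sum.neutral)
  \<comment> \<open>\<open>K\<close> stands for the support of the image of \<open>u\<close> in the
    group ring; it is finite, so a class of lowest degree exists.\<close>
  define K where "K = {e \<in> Poly_Mapping.keys u. class_sum u (exponent e) \<noteq> 0}"
  obtain e where "e \<in> Poly_Mapping.keys u" "exponent e - v \<in> \<L>" using rep[OF v] by blast
  then have "e \<in> K" using class_sum_cong[of "exponent e" v u] v by (simp add: K_def)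
  then have "K \<noteq> {}" by blast
  moreover have "finite K" by (simp add: K_def)
  ultimately obtain e0 where e0: "e0 \<in> K" "\<And>e. e \<in> K \<Longrightarrow> wdeg (exponent e0) \<le> wdeg (exponent e)"
    using ex_min_if_finite[of "(\<lambda>e. wdeg (exponent e)) ` K"] by (auto simp: not_less)
  have low: "class_sum u w = 0" if "wdeg w < wdeg (exponent e0)" for w
  proof (rule ccontr)
    assume w: "class_sum u w \<noteq> 0"
    then obtain e where e: "e \<in> Poly_Mapping.keys u" "exponent e - w \<in> \<L>" using rep by blast
    then have "e \<in> K" using class_sum_cong[OF e(2), of u] w by (simp add: K_def)
    then show False using e0(2) wdeg_cong[OF e(2)] that by fastforce
  qed
  have "Poly_Mapping.keys q \<noteq> {}" using q(2) by simp
  then obtain k0 where k0: "k0 \<in> Poly_Mapping.keys q"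
      "\<And>k. k \<in> Poly_Mapping.keys q \<Longrightarrow> Poly_Mapping.lookup k0 s \<le> Poly_Mapping.lookup k s"
    using ex_min_if_finite[of "(\<lambda>k. Poly_Mapping.lookup k s) ` Poly_Mapping.keys q"] by (auto simp: not_less)
  have uni: "\<forall>i. i \<noteq> s \<longrightarrow> Poly_Mapping.lookup k i = 0" if "k \<in> Poly_Mapping.keys q" for k
    using q(1) that by (simp add: univariate_def)
  \<comment> \<open>Any other term of \<open>q\<close> has a larger exponent of t_s, and would have
    to meet a class of \<open>u\<close> below the lowest degree.\<close>
  have other: "class_sum u (exponent k0 + exponent e0 - exponent k) = 0"
    if k: "k \<in> Poly_Mapping.keys q - {k0}" for k
  proof (rule low)
    have "Poly_Mapping.lookup k s \<noteq> Poly_Mapping.lookup k0 s"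
      using k uni k0(1) poly_mapping_eqI[of k k0] by (metis DiffD1 DiffD2 singletonI)
    then have "d s * real (Poly_Mapping.lookup k0 s) < d s * real (Poly_Mapping.lookup k s)"
      using k0(2)[of k] k d_pos[of s] by simp
    then show "wdeg (exponent k0 + exponent e0 - exponent k) < wdeg (exponent e0)"
      using wdeg_univariate[OF uni, of k] wdeg_univariate[OF uni[OF k0(1)]] k
      by (simp add: wdeg_add wdeg_diff)
  qed
  have "class_sum (q * u) (exponent k0 + exponent e0) =
      Poly_Mapping.lookup q k0 * class_sum u (exponent e0) +
      (\<Sum>k\<in>Poly_Mapping.keys q - {k0}.
        Poly_Mapping.lookup q k * class_sum u (exponent k0 + exponent e0 - exponent k))"
    unfolding class_sum_mult using k0(1) by (subst sum.remove[of _ k0]) auto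
  also have "\<dots> = Poly_Mapping.lookup q k0 * class_sum u (exponent e0)"
    using other by simp
  finally show False
    using qu e0(1) k0(1) by (auto simp: lattice_ideal_iff_class_sum K_def in_keys_iff)
qed

text \<open>A vector of natural numbers of weighted degree 0 vanishes, so the class of 0 contains
  only the constant term.\<close>

lemma constant_coeff_lattice_ideal:
  assumes "u \<in> (lattice_ideal \<L> :: ('n, 'k::field) mpoly set)"
  shows "constant_coeff u = 0"
proof -
  have "e = 0" if "exponent e \<in> \<L>" for e
  proof (rule poly_mapping_eqI)
    fix i
    have "(\<Sum>i\<in>UNIV. d i * real (Poly_Mapping.lookup e i)) = 0" using homogeneous[OF that] by simp
    then have "d i * real (Poly_Mapping.lookup e i) = 0"
      using d_pos by (subst (asm) sum_nonneg_eq_0_iff) (auto simp: less_imp_le)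
    then show "Poly_Mapping.lookup e i = Poly_Mapping.lookup 0 i" using d_pos[of i] by simp
  qed
  moreover have "exponent 0 \<in> \<L>" using zero_mem by (simp add: exponent_def zero_vec_def)
  ultimately have "class_sum u 0 = (\<Sum>e\<in>Poly_Mapping.keys u. if e = 0 then Poly_Mapping.lookup u 0 else 0)"
    unfolding class_sum_def by (intro sum.cong) auto
  also have "\<dots> = constant_coeff u"
    by (auto simp: constant_coeff_def in_keys_iff)
  finally show ?thesis using assms by (simp add: lattice_ideal_iff_class_sum)
qed

end

section \<open>Ideals of GPCB matrices\<close>

text \<open>\<open>L\<close> is a singular M-matrix: replacing a left null vector by its absolute values keeps it a
  left null vector, because the positive right null vector \<open>b\<close> turns all inequalities into
  equalities.\<close>

lemma positive_left_null_vector: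
  fixes L :: "int ^ 'n::finite ^ 'n"
  assumes diag: "\<And>i. 0 < L $ i $ i" and off: "\<And>i j. i \<noteq> j \<Longrightarrow> L $ i $ j < 0"
    and b: "\<And>i. 0 < b i" and Lb: "\<And>i. (\<Sum>j\<in>UNIV. L $ i $ j * b j) = 0"
  shows "\<exists>d :: 'n \<Rightarrow> real. (\<forall>i. 0 < d i) \<and> (\<forall>j. (\<Sum>i\<in>UNIV. d i * real_of_int (L $ i $ j)) = 0)"
proof -
  define A :: "real ^ 'n ^ 'n" where "A = (\<chi> i j. real_of_int (L $ i $ j))"
  define x :: "real ^ 'n" where "x = (\<chi> i. real_of_int (b i))"
  have "(\<Sum>j\<in>UNIV. real_of_int (L $ i $ j) * real_of_int (b j)) = 0" for i
  proof -
    have "(\<Sum>j\<in>UNIV. real_of_int (L $ i $ j) * real_of_int (b j)) =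
        real_of_int (\<Sum>j\<in>UNIV. L $ i $ j * b j)" by simp
    then show ?thesis using Lb by simp
  qed
  then have "A *v x = 0" by (simp add: A_def x_def matrix_vector_mult_def vec_eq_iff)
  moreover have "x \<noteq> 0" using b by (auto simp: x_def vec_eq_iff less_imp_neq[symmetric])
  \<comment> \<open>A nonzero kernel vector makes \<open>A\<close> singular, hence its transpose has
    a nonzero kernel vector as well.\<close>
  ultimately have "\<nexists>B. B ** A = mat 1" using matrix_left_invertible_ker[of A] by blast
  then have noinv: "\<nexists>B. A ** B = mat 1" using matrix_left_right_inverse by blast
  have "\<nexists>B. B ** transpose A = mat 1"
  proof
    assume "\<exists>B. B ** transpose A = mat 1"
    then obtain B where "B ** transpose A = mat 1" by blast
    then have "transpose (B ** transpose A) = mat 1" by (simp add: transpose_mat)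
    then have "A ** transpose B = mat 1" by (simp add: matrix_transpose_mul transpose_transpose)
    then show False using noinv by blast
  qed
  then obtain w where w: "transpose A *v w = 0" "w \<noteq> 0"
    using matrix_left_invertible_ker[of "transpose A"] by blast
  have w0: "(\<Sum>i\<in>UNIV. real_of_int (L $ i $ j) * w $ i) = 0" for j
  proof -
    have "(transpose A *v w) $ j = (\<Sum>i\<in>UNIV. real_of_int (L $ i $ j) * w $ i)"
      by (simp add: matrix_vector_mult_def transpose_def A_def)
    then show ?thesis using w(1) by simp
  qed
  define d where "d i = \<bar>w $ i\<bar>" for i
  define g where "g j = (\<Sum>i\<in>UNIV. d i * real_of_int (L $ i $ j))" for j
  have split: "(\<Sum>i\<in>UNIV. F i) = F j + (\<Sum>i\<in>UNIV - {j}. F i)" for F :: "'n \<Rightarrow> real" and j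
    by (rule sum.remove) auto
  \<comment> \<open>Triangle inequality in column \<open>j\<close>: the diagonal term is bounded by
    the off-diagonal ones, which carry the opposite sign.\<close>
  have g_le: "g j \<le> 0" for j
  proof -
    have "real_of_int (L $ j $ j) * d j = \<bar>real_of_int (L $ j $ j) * w $ j\<bar>"
      using diag[of j] by (simp add: d_def abs_mult)
    also have "\<dots> = \<bar>\<Sum>i\<in>UNIV - {j}. real_of_int (L $ i $ j) * w $ i\<bar>"
      using w0[of j] split[of "\<lambda>i. real_of_int (L $ i $ j) * w $ i" j] by linarith
    also have "\<dots> \<le> (\<Sum>i\<in>UNIV - {j}. \<bar>real_of_int (L $ i $ j) * w $ i\<bar>)" by (rule sum_abs)
    also have "\<dots> = - (\<Sum>i\<in>UNIV - {j}. d i * real_of_int (L $ i $ j))"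
      unfolding sum_negf[symmetric] using off
      by (intro sum.cong) (auto simp: d_def abs_mult abs_of_neg mult.commute)
    finally show ?thesis
      unfolding g_def using split[of "\<lambda>i. d i * real_of_int (L $ i $ j)" j] by (simp add: mult.commute)
  qed
  \<comment> \<open>Pairing the nonnegative \<open>- g j\<close> with the positive
    \<open>b j\<close> gives 0, because the rows annihilate \<open>b\<close>; so every
    \<open>g j\<close> vanishes.\<close>
  have "(\<Sum>j\<in>UNIV. real_of_int (b j) * - g j) =
      - (\<Sum>j\<in>UNIV. \<Sum>i\<in>UNIV. d i * (real_of_int (L $ i $ j) * real_of_int (b j)))"
    by (simp add: g_def sum_distrib_left sum_negf mult_ac)
  also have "\<dots> = - (\<Sum>i\<in>UNIV. d i * (\<Sum>j\<in>UNIV. real_of_int (L $ i $ j) * real_of_int (b j)))"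
    by (subst sum.swap) (simp add: sum_distrib_left)
  also have "\<dots> = 0"
    using \<open>\<And>i. (\<Sum>j\<in>UNIV. real_of_int (L $ i $ j) * real_of_int (b j)) = 0\<close> by simp
  finally have "real_of_int (b j) * - g j = 0" for j
    using b g_le by (subst (asm) sum_nonneg_eq_0_iff) (auto simp: less_imp_le mult_nonneg_nonpos)
  then have g0: "g j = 0" for j using b[of j] by (metis less_irrefl mult_eq_0_iff neg_equal_0_iff_equal of_int_eq_0_iff)
  \<comment> \<open>A zero of \<open>d\<close> would spread: column \<open>i\<close> becomes a
    vanishing sum of nonnegative terms with nonzero matrix entries, so \<open>w\<close> would be
    0.\<close>
  have "0 < d i" for i
  proof (rule ccontr)
    assume "\<not> 0 < d i"
    then have di: "d i = 0" by (simp add: d_def)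
    have "(\<Sum>j\<in>UNIV - {i}. d j * real_of_int (- (L $ j $ i))) = 0"
      using g0[of i] split[of "\<lambda>j. d j * real_of_int (L $ j $ i)" i] di by (simp add: g_def sum_negf)
    then have "\<forall>j\<in>UNIV - {i}. d j * real_of_int (- (L $ j $ i)) = 0"
      using off by (subst (asm) sum_nonneg_eq_0_iff) (auto simp: d_def less_imp_le mult_nonneg_nonpos)
    then have "d j = 0" for j using di off[of j i] by (cases "j = i") auto
    then show False using w(2) by (simp add: d_def vec_eq_iff)
  qed
  then show ?thesis using g0 unfolding g_def by blast
qed

text \<open>The distinguished index \<open>s\<close> is arbitrary here; it becomes the largest index
  in \<open>telescoping_mem_J\<close>.\<close>

locale gpcb_matrix =
  fixes L :: "((int, 'n) vec, 'n::{finite,linorder}) vec" and b :: "(int, 'n) vec" and s :: 'n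
  assumes diag: "0 < L $ i $ i" and off_diag: "i \<noteq> j \<Longrightarrow> L $ i $ j < 0"
    and b_pos: "0 < b $ i" and L_b: "(\<Sum>j\<in>UNIV. L $ i $ j * b $ j) = 0"
begin

definition weight :: "'n \<Rightarrow> real" where
  "weight = (SOME d. (\<forall>i. 0 < d i) \<and> (\<forall>j. (\<Sum>i\<in>UNIV. d i * real_of_int (L $ i $ j)) = 0))"

lemma weight: "0 < weight i" "(\<Sum>i\<in>UNIV. weight i * real_of_int (L $ i $ j)) = 0"
  using someI_ex[OF positive_left_null_vector[of L "\<lambda>i. b $ i", OF diag off_diag b_pos L_b]]
  unfolding weight_def by blast+

lemma column_mem: "column j L \<in> column_lattice L"
proof -
  have "column j L = (\<Sum>i\<in>UNIV. (if i = j then 1 else 0) *s column i L)"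
    by (simp add: vec_eq_iff if_distrib[of "\<lambda>c. c * _"] cong: if_cong)
  then show ?thesis unfolding column_lattice_def by (auto intro: exI[of _ "\<lambda>i. if i = j then 1 else 0"])
qed

sublocale homogeneous_lattice "column_lattice L" weight
proof
  show "0 \<in> column_lattice L"
    unfolding column_lattice_def by (auto intro!: exI[of _ "\<lambda>_. 0"] simp: vec_eq_iff)
  show "a - c \<in> column_lattice L" if "a \<in> column_lattice L" "c \<in> column_lattice L" for a c
  proof -
    from that obtain k l where "a = (\<Sum>j\<in>UNIV. k j *s column j L)" "c = (\<Sum>j\<in>UNIV. l j *s column j L)"
      unfolding column_lattice_def by auto
    then have "a - c = (\<Sum>j\<in>UNIV. (k j - l j) *s column j L)"
      by (simp add: vec.scale_left_diff_distrib sum_subtractf vec_eq_iff left_diff_distrib)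
    then show ?thesis unfolding column_lattice_def by (auto intro: exI[of _ "\<lambda>j. k j - l j"])
  qed
  show "0 < weight i" for i by (rule weight)
  show "(\<Sum>i\<in>UNIV. weight i * real_of_int (a $ i)) = 0" if "a \<in> column_lattice L" for a
  proof -
    from that obtain k where a: "a = (\<Sum>j\<in>UNIV. k j *s column j L)"
      unfolding column_lattice_def by auto
    have "(\<Sum>i\<in>UNIV. weight i * real_of_int (a $ i)) =
        (\<Sum>i\<in>UNIV. \<Sum>j\<in>UNIV. real_of_int (k j) * (weight i * real_of_int (L $ i $ j)))"
      by (simp add: a column_def sum_distrib_left mult_ac)
    also have "\<dots> = (\<Sum>j\<in>UNIV. real_of_int (k j) * (\<Sum>i\<in>UNIV. weight i * real_of_int (L $ i $ j)))"
      by (subst sum.swap) (simp add: sum_distrib_left)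
    finally show ?thesis by (simp add: weight)
  qed
qed

section \<open>The ideals of the matrix and saturation by monomials\<close>

definition J :: "('n, 'k::field) mpoly set" where
  "J = idl.span (matrix_binomial L ` (UNIV - {s}))"

lemma matrix_ideal_eq_span: "matrix_ideal L = idl.span (range (matrix_binomial L))"
  by (simp add: matrix_ideal_def Idl_eq_span)

lemma subspace_J: "idl.subspace J"
  by (simp add: J_def)

lemma subspace_matrix_ideal: "idl.subspace (matrix_ideal L :: ('n, 'k::field) mpoly set)"
  by (simp add: matrix_ideal_eq_span)

lemma matrix_binomial_eq:
  "matrix_binomial L i =
    monomial (\<lambda>j. if j = i then nat (L $ i $ i) else 0) -
    (monomial (\<lambda>j. nat (- (L $ j $ i))) :: ('n, 'k::comm_ring_1) mpoly)"
proof -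
  \<comment> \<open>\<open>nat\<close> sends the negative of the positive diagonal entry to 0, so
    the case distinction may be dropped.\<close>
  have "(\<lambda>j. if j = i then 0 else nat (- (L $ j $ i))) = (\<lambda>j. nat (- (L $ j $ i)))"
    using diag[of i] by auto
  then show ?thesis
    unfolding matrix_binomial_def prod_var_power_eq_monomial
    unfolding var_power_eq_monomial by simp
qed

lemma matrix_binomial_eq_lattice_binomial: "matrix_binomial L i = lattice_binomial (column i L)"
proof -
  have "(\<lambda>j. if j = i then nat (L $ i $ i) else 0) = (\<lambda>j. nat (L $ j $ i))"
    using off_diag less_imp_le by (fastforce intro!: ext)
  then show ?thesis by (simp add: matrix_binomial_eq lattice_binomial_def column_def)
qed

lemma J_subset_matrix_ideal: "J \<subseteq> matrix_ideal L"
  unfolding J_def matrix_ideal_eq_span by (intro idl.span_mono) auto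

lemma matrix_ideal_subset_lattice_ideal:
  "matrix_ideal L \<subseteq> (lattice_ideal (column_lattice L) :: ('n, 'k::field) mpoly set)"
  unfolding matrix_ideal_eq_span lattice_ideal_eq_span
  using column_mem by (intro idl.span_mono) (auto simp: matrix_binomial_eq_lattice_binomial)

text \<open>Trading \<open>x ^ m\<close> for \<open>y ^ m\<close> subtracts \<open>m\<close> times
  column \<open>k\<close> from the exponents, and \<open>x ^ m - y ^ m\<close> is a multiple of
  \<open>x - y\<close>, the binomial of that column.\<close>

lemma monomial_step:
  assumes "\<And>i. int (c' i) = int (c i) - int m * L $ i $ k" and "m * nat (L $ k $ k) \<le> c k"
  shows "\<exists>r. monomial c - monomial c' = r * (matrix_binomial L k :: ('n, 'k::comm_ring_1) mpoly)"
proof -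
  define e where "e i = c i - (if i = k then m * nat (L $ k $ k) else 0)" for i
  define x y :: "('n, 'k) mpoly" where
    "x = monomial (\<lambda>j. if j = k then nat (L $ k $ k) else 0)" and "y = monomial (\<lambda>j. nat (- (L $ j $ k)))"
  have "e i + m * (if i = k then nat (L $ k $ k) else 0) = c i" for i
    using assms(2) by (auto simp: e_def)
  then have c: "monomial c = monomial e * x ^ m"
    unfolding x_def monomial_power monomial_mult by simp
  have "e i + m * nat (- (L $ i $ k)) = c' i" for i
  proof (cases "i = k")
    case True
    then have "int (c' i) = int (c i) - int (m * nat (L $ k $ k))" using assms(1)[of i] diag[of k] by simp
    then have "c' i = c i - m * nat (L $ k $ k)" by linarith
    then show ?thesis using True diag[of k] by (simp add: e_def)
  next
    case False
    then have "int (c' i) = int (c i + m * nat (- (L $ i $ k)))" using assms(1)[of i] off_diag[of i k] by simp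
    then show ?thesis using False by (simp only: of_nat_eq_iff) (simp add: e_def)
  qed
  then have c': "monomial c' = monomial e * y ^ m"
    unfolding y_def monomial_power monomial_mult by simp
  have "monomial c - monomial c' = monomial e * (x ^ m - y ^ m)"
    by (simp add: c c' right_diff_distrib)
  also have "\<dots> = (monomial e * (\<Sum>i<m. y ^ (m - Suc i) * x ^ i)) * (x - y)"
    unfolding power_diff_sumr2 by (simp add: mult_ac)
  finally show ?thesis unfolding x_def y_def matrix_binomial_eq by blast
qed

text \<open>After \<open>k\<close> rewritings with column \<open>j\<close> every other variable has
  exponent at least \<open>k\<close>, a common bound for the \<open>c i\<close>; the summand
  \<open>c j\<close> in \<open>M\<close> supplies \<open>var j\<close> itself.\<close>

lemma var_power_cong_multiple:
  "\<exists>M r. var j ^ M - r * monomial c \<in> (matrix_ideal L :: ('n, 'k::field) mpoly set)"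
proof -
  define k where "k = (\<Sum>i\<in>UNIV. c i)"
  define M where "M = k * nat (L $ j $ j) + c j"
  define c0 where "c0 i = (if i = j then M else 0)" for i
  define c1 where "c1 i = (if i = j then c j else k * nat (- (L $ i $ j)))" for i
  have "c i \<le> c1 i" for i
  proof (cases "i = j")
    case False
    have "c i \<le> k" unfolding k_def by (intro member_le_sum) auto
    also have "k * 1 \<le> k * nat (- (L $ i $ j))"
      using off_diag[OF False] by (intro mult_left_mono) auto
    finally show ?thesis using False by (simp add: c1_def)
  qed (simp add: c1_def)
  then have "monomial c1 = monomial (\<lambda>i. c1 i - c i) * (monomial c :: ('n, 'k) mpoly)"
    unfolding monomial_mult by simp
  moreover have "int (c1 i) = int (c0 i) - int k * L $ i $ j" for i
    using diag[of j] off_diag[of i j] by (cases "i = j") (simp_all add: c0_def c1_def M_def)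
  then obtain r where "monomial c0 - monomial c1 = r * (matrix_binomial L j :: ('n, 'k) mpoly)"
    using monomial_step[of c1 c0 k j] by (auto simp: c0_def M_def)
  then have "monomial c0 - monomial c1 \<in> (matrix_ideal L :: ('n, 'k) mpoly set)"
    unfolding matrix_ideal_eq_span by (auto intro: idl.span_scale idl.span_base)
  moreover have "monomial c0 = (var j ^ M :: ('n, 'k) mpoly)"
    unfolding var_power_eq_monomial c0_def by simp
  ultimately show ?thesis by (intro exI[of _ M] exI[of _ "monomial (\<lambda>i. c1 i - c i)"]) simp
qed

text \<open>Saturation by all monomials reduces to saturation by one variable, some power of which
  is a multiple of the given monomial modulo the ideal.\<close>

lemma power_var_mult_mem:
  assumes "monomial c * u \<in> (matrix_ideal L :: ('n, 'k::field) mpoly set)"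
  shows "\<exists>M. var j ^ M * u \<in> matrix_ideal L"
proof -
  obtain M r where r: "var j ^ M - r * monomial c \<in> (matrix_ideal L :: ('n, 'k) mpoly set)"
    using var_power_cong_multiple by blast
  have "u * (var j ^ M - r * monomial c) + r * (monomial c * u) \<in> matrix_ideal L"
    by (intro idl.subspace_add[OF subspace_matrix_ideal]
        idl.subspace_scale[OF subspace_matrix_ideal r] idl.subspace_scale[OF subspace_matrix_ideal assms])
  moreover have "u * (var j ^ M - r * monomial c) + r * (monomial c * u) = var j ^ M * u"
    by (simp add: algebra_simps)
  ultimately show ?thesis by auto
qed

text \<open>This is the saturation of the matrix ideal by the product of all variables.\<close>

definition monomial_saturation :: "('n, 'k::field) mpoly set" where
  "monomial_saturation = {u. \<exists>c. monomial c * u \<in> matrix_ideal L}"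

lemma subspace_monomial_saturation: "idl.subspace (monomial_saturation :: ('n, 'k::field) mpoly set)"
proof (rule idl.subspaceI)
  show "0 \<in> (monomial_saturation :: ('n, 'k) mpoly set)"
    by (simp add: monomial_saturation_def idl.subspace_0[OF subspace_matrix_ideal])
  fix u v :: "('n, 'k) mpoly" and w
  assume u: "u \<in> monomial_saturation"
  then obtain c where c: "monomial c * u \<in> matrix_ideal L" by (auto simp: monomial_saturation_def)
  then have "monomial c * (w * u) \<in> matrix_ideal L"
    using idl.subspace_scale[OF subspace_matrix_ideal c, of w] by (simp add: mult_ac)
  then show "w * u \<in> monomial_saturation" by (auto simp: monomial_saturation_def)
  assume "v \<in> monomial_saturation"
  then obtain c' where c': "monomial c' * v \<in> matrix_ideal L" by (auto simp: monomial_saturation_def)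
  have "monomial c' * (monomial c * u) + monomial c * (monomial c' * v) \<in> matrix_ideal L"
    by (intro idl.subspace_add[OF subspace_matrix_ideal]
        idl.subspace_scale[OF subspace_matrix_ideal c] idl.subspace_scale[OF subspace_matrix_ideal c'])
  then have "monomial (\<lambda>i. c i + c' i) * (u + v) \<in> matrix_ideal L"
    unfolding monomial_mult[symmetric] by (simp add: algebra_simps)
  then show "u + v \<in> monomial_saturation" by (auto simp: monomial_saturation_def)
qed

lemma monomial_saturation_cancel:
  "monomial c * u \<in> monomial_saturation \<Longrightarrow> u \<in> monomial_saturation"
  unfolding monomial_saturation_def by (auto simp: monomial_mult simp flip: mult.assoc)

lemma monomial_diff_mem_saturation:
  assumes "a \<in> column_lattice L" and "\<And>i. int (c i) - int (c' i) = a $ i"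
  shows "monomial c - monomial c' \<in> (monomial_saturation :: ('n, 'k::field) mpoly set)"
proof -
  define V where "V = {a :: (int, 'n) vec. \<forall>c c'. (\<forall>i. int (c i) - int (c' i) = a $ i) \<longrightarrow>
    monomial c - monomial c' \<in> (monomial_saturation :: ('n, 'k) mpoly set)}"
  note sub = subspace_monomial_saturation
  have zero: "0 \<in> V"
    unfolding V_def
  proof clarify
    fix c c' :: "'n \<Rightarrow> nat" assume "\<forall>i. int (c i) - int (c' i) = (0 :: (int, 'n) vec) $ i"
    then have "c = c'" by (intro ext) simp
    then show "monomial c - monomial c' \<in> (monomial_saturation :: ('n, 'k) mpoly set)"
      by (simp add: idl.subspace_0[OF sub])
  qed
  have neg: "- a \<in> V" if "a \<in> V" for a
    unfolding V_def
  proof clarify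
    fix c c' :: "'n \<Rightarrow> nat" assume "\<forall>i. int (c i) - int (c' i) = (- a) $ i"
    then have "\<forall>i. int (c' i) - int (c i) = a $ i" by (metis minus_diff_eq minus_minus vector_uminus_component)
    then have "monomial c' - monomial c \<in> (monomial_saturation :: ('n, 'k) mpoly set)"
      using that unfolding V_def by blast
    from idl.subspace_neg[OF sub this] show "monomial c - monomial c' \<in> (monomial_saturation :: ('n, 'k) mpoly set)"
      by simp
  qed
  have add: "a + a' \<in> V" if "a \<in> V" "a' \<in> V" for a a'
    unfolding V_def
  proof clarify
    fix c c' :: "'n \<Rightarrow> nat" assume c: "\<forall>i. int (c i) - int (c' i) = (a + a') $ i"
    \<comment> \<open>The factor \<open>monomial k\<close> keeps the intermediate exponent
      \<open>c''\<close> nonnegative; it is cancelled at the end.\<close>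
    define k where "k i = nat \<bar>a $ i\<bar>" for i
    define c'' where "c'' i = nat (int (c i + k i) - a $ i)" for i
    have c'': "int (c'' i) = int (c i + k i) - a $ i" for i by (simp add: c''_def k_def)
    have "monomial (\<lambda>i. c i + k i) - monomial c'' \<in> (monomial_saturation :: ('n, 'k) mpoly set)"
      using that(1) c'' unfolding V_def by simp
    moreover have "monomial c'' - monomial (\<lambda>i. c' i + k i) \<in> (monomial_saturation :: ('n, 'k) mpoly set)"
      using that(2) c'' c unfolding V_def by (simp add: algebra_simps)
    ultimately have "monomial (\<lambda>i. c i + k i) - monomial (\<lambda>i. c' i + k i) \<in> (monomial_saturation :: ('n, 'k) mpoly set)"
      using idl.subspace_add[OF sub] by fastforce
    then have "monomial k * (monomial c - monomial c') \<in> (monomial_saturation :: ('n, 'k) mpoly set)"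
      unfolding right_diff_distrib monomial_mult by (simp add: add.commute)
    then show "monomial c - monomial c' \<in> (monomial_saturation :: ('n, 'k) mpoly set)"
      by (rule monomial_saturation_cancel)
  qed
  have col: "column j L \<in> V" for j
    unfolding V_def
  proof clarify
    fix c c' :: "'n \<Rightarrow> nat" assume "\<forall>i. int (c i) - int (c' i) = column j L $ i"
    then have "monomial c - monomial c' = monomial (\<lambda>i. min (c i) (c' i)) * (matrix_binomial L j :: ('n, 'k) mpoly)"
      unfolding matrix_binomial_eq_lattice_binomial by (intro monomial_diff_factor) blast
    also have "\<dots> \<in> matrix_ideal L"
      unfolding matrix_ideal_eq_span by (intro idl.span_scale idl.span_base) auto
    finally have "monomial (\<lambda>_. 0) * (monomial c - monomial c') \<in> (matrix_ideal L :: ('n, 'k) mpoly set)"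
      by (simp add: monomial_def)
    then show "monomial c - monomial c' \<in> (monomial_saturation :: ('n, 'k) mpoly set)"
      unfolding monomial_saturation_def by blast
  qed
  have nat_mult: "int n *s a \<in> V" if "a \<in> V" for n a
    using that by (induction n) (auto simp: zero vec.scale_left_distrib intro: add)
  have int_mult: "k *s a \<in> V" if "a \<in> V" for k a
  proof (cases "0 \<le> k")
    case True
    then show ?thesis using nat_mult[OF that, of "nat k"] by simp
  next
    case False
    moreover have "- (- k *s a) = k *s a" by (simp add: vec_eq_iff)
    ultimately show ?thesis using neg[OF nat_mult[OF that, of "nat (- k)"]] by simp
  qed
  have "(\<Sum>j\<in>F. k j *s column j L) \<in> V" if "finite F" for F k
    using that by (induction F) (auto simp: zero intro: add int_mult col)
  then have "a \<in> V" using assms(1) unfolding column_lattice_def by auto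
  then show ?thesis using assms(2) unfolding V_def by blast
qed

lemma lattice_ideal_power_var:
  assumes "u \<in> (lattice_ideal (column_lattice L) :: ('n, 'k::field) mpoly set)"
  shows "\<exists>M. var j ^ M * u \<in> matrix_ideal L"
proof -
  have "lattice_binomial a \<in> (monomial_saturation :: ('n, 'k) mpoly set)" if "a \<in> column_lattice L" for a
    unfolding lattice_binomial_def using that by (intro monomial_diff_mem_saturation) auto
  then have "lattice_ideal (column_lattice L) \<subseteq> (monomial_saturation :: ('n, 'k) mpoly set)"
    unfolding lattice_ideal_eq_span by (intro idl.span_minimal subspace_monomial_saturation) blast
  then show ?thesis using assms power_var_mult_mem unfolding monomial_saturation_def by blast
qed

text \<open>Row \<open>s\<close> is negative off the diagonal. This is the shape of generators that
  \<open>var_nonzerodivisor\<close> expects.\<close>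

lemma tail_divisible:
  assumes "i \<noteq> s"
  shows "\<exists>z. matrix_binomial L i = var i ^ nat (L $ i $ i) - var s * (z :: ('n, 'k::comm_ring_1) mpoly)"
proof -
  have "nat (- (L $ s $ i)) \<ge> 1" using off_diag[of s i] assms by auto
  then have "(\<lambda>j. nat (- (L $ j $ i))) =
      (\<lambda>j. (if j = s then 1 else 0) + (nat (- (L $ j $ i)) - (if j = s then 1 else 0)))"
    by (intro ext) auto
  then have "monomial (\<lambda>j. nat (- (L $ j $ i))) =
      (var s ^ 1 * monomial (\<lambda>j. nat (- (L $ j $ i)) - (if j = s then 1 else 0)) :: ('n, 'k) mpoly)"
    unfolding var_power_eq_monomial monomial_mult by (rule arg_cong)
  then show ?thesis
    unfolding matrix_binomial_eq var_power_eq_monomial[symmetric, of i] by auto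
qed

lemma J_power_var_cancel:
  assumes "var s ^ M * u \<in> (J :: ('n, 'k::field) mpoly set)"
  shows "u \<in> J"
  using assms
proof (induction M)
  case (Suc M)
  have "\<forall>i. \<exists>z. i \<noteq> s \<longrightarrow> matrix_binomial L i = var i ^ nat (L $ i $ i) - var s * (z :: ('n, 'k) mpoly)"
    using tail_divisible by blast
  then obtain z :: "'n \<Rightarrow> ('n, 'k) mpoly" where
    z: "\<And>i. i \<noteq> s \<Longrightarrow> matrix_binomial L i = var i ^ nat (L $ i $ i) - var s * z i" by metis
  have "var s ^ M * u \<in> J"
    unfolding J_def
  proof (rule var_nonzerodivisor)
    show "matrix_binomial L i = var i ^ nat (L $ i $ i) - var s * z i" if "i \<in> UNIV - {s}" for i
      using z that by blast
    show "var s * (var s ^ M * u) \<in> idl.span (matrix_binomial L ` (UNIV - {s}))"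
      using Suc.prems by (simp add: J_def mult.assoc)
  qed auto
  then show ?case by (rule Suc.IH)
qed simp

text \<open>\<open>g\<close> multiplies the whole matrix ideal into \<open>J\<close>. A power of
  \<open>var s\<close> moves \<open>u\<close> into the matrix ideal, and it cancels modulo
  \<open>J\<close>.\<close>

lemma lattice_ideal_mult_mem_J:
  assumes g: "g * matrix_binomial L s \<in> (J :: ('n, 'k::field) mpoly set)"
    and u: "u \<in> lattice_ideal (column_lattice L)"
  shows "u * g \<in> J"
proof -
  have "matrix_ideal L \<subseteq> {v. v * g \<in> (J :: ('n, 'k) mpoly set)}"
    unfolding matrix_ideal_eq_span
  proof (rule idl.span_minimal)
    have "matrix_binomial L i * g \<in> J" for i
    proof (cases "i = s")
      case False
      then have "g * matrix_binomial L i \<in> J"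
        unfolding J_def by (intro idl.span_scale idl.span_base) auto
      then show ?thesis by (simp add: mult.commute)
    qed (use g in \<open>simp add: mult.commute\<close>)
    then show "range (matrix_binomial L) \<subseteq> {v. v * g \<in> J}" by blast
    show "idl.subspace {v. v * g \<in> (J :: ('n, 'k) mpoly set)}"
      using subspace_J
      by (intro idl.subspaceI)
        (auto simp: idl.subspace_0 distrib_right mult.assoc intro: idl.subspace_add idl.subspace_scale)
  qed
  moreover obtain M where "var s ^ M * u \<in> matrix_ideal L" using lattice_ideal_power_var[OF u] by blast
  ultimately have "var s ^ M * (u * g) \<in> J" by (auto simp: mult.assoc)
  then show ?thesis by (rule J_power_var_cancel)
qed


section \<open>Finiteness of S/J over K[t_s]\<close>

lemma matrix_binomial_dvd_J:
  "i \<noteq> s \<Longrightarrow> r * matrix_binomial L i \<in> (J :: ('n, 'k::field) mpoly set)"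
  unfolding J_def by (intro idl.span_scale idl.span_base) auto

text \<open>The monomials with these exponents generate the quotient by \<open>J\<close> over
  \<open>univariate s\<close>; the bound 1 at \<open>s\<close> forces exponent 0, as powers of
  \<open>var s\<close> count as coefficients.\<close>

definition reduced :: "('n \<Rightarrow> nat) set" where
  "reduced = PiE UNIV (\<lambda>i. {..<if i = s then 1 else nat (L $ i $ i)})"

lemma finite_reduced: "finite reduced"
  unfolding reduced_def by (intro finite_PiE) auto

text \<open>The rewriting \<open>x\<^sub>k \<mapsto> y\<^sub>k\<close> with \<open>k \<noteq> s\<close> preserves the weighted degree and raises the
  exponent of \<open>t\<^sub>s\<close>, hence terminates.\<close>

lemma monomial_reduce:
  "\<exists>e\<in>reduced. \<exists>q\<in>univariate s. monomial c - q * monomial e \<in> (J :: ('n, 'k::field) mpoly set)"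
\<comment> \<open>The weighted degree divided by \<open>weight s\<close> bounds the exponent of t_s,
  so the truncated subtraction really decreases.\<close>
proof (induction "nat \<lfloor>(\<Sum>i\<in>UNIV. weight i * real (c i)) / weight s\<rfloor> - c s" arbitrary: c rule: less_induct)
  case less
  show ?case
  proof (cases "\<exists>k. k \<noteq> s \<and> nat (L $ k $ k) \<le> c k")
    case True
    then obtain k where k: "k \<noteq> s" "nat (L $ k $ k) \<le> c k" by blast
    define c' where "c' i = nat (int (c i) - L $ i $ k)" for i
    have c': "int (c' i) = int (c i) - L $ i $ k" for i
      using k off_diag[of i k] by (cases "i = k") (auto simp: c'_def)
    obtain r where "monomial c - monomial c' = r * (matrix_binomial L k :: ('n, 'k) mpoly)"
      using monomial_step[of c' c 1 k] c' k by auto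
    then have cc: "monomial c - monomial c' \<in> (J :: ('n, 'k) mpoly set)"
      using matrix_binomial_dvd_J[OF k(1)] by simp
    have "real (c' i) = real (c i) - real_of_int (L $ i $ k)" for i
      using c'[of i] by linarith
    then have deg: "(\<Sum>i\<in>UNIV. weight i * real (c' i)) = (\<Sum>i\<in>UNIV. weight i * real (c i))"
      using weight(2)[of k] by (simp add: right_diff_distrib sum_subtractf)
    have "weight s * real (c' s) \<le> (\<Sum>i\<in>UNIV. weight i * real (c' i))"
      using weight(1) by (intro member_le_sum) (auto simp: less_imp_le)
    then have "real (c' s) \<le> (\<Sum>i\<in>UNIV. weight i * real (c' i)) / weight s"
      using weight(1)[of s] by (simp add: field_simps)
    then have "c' s \<le> nat \<lfloor>(\<Sum>i\<in>UNIV. weight i * real (c i)) / weight s\<rfloor>"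
      using deg by (simp add: le_nat_floor)
    moreover have "L $ s $ k < 0" using off_diag[of s k] k by simp
    then have "c s < c' s" using c'[of s] by linarith
    ultimately have "nat \<lfloor>(\<Sum>i\<in>UNIV. weight i * real (c' i)) / weight s\<rfloor> - c' s <
        nat \<lfloor>(\<Sum>i\<in>UNIV. weight i * real (c i)) / weight s\<rfloor> - c s"
      unfolding deg by linarith
    from less[OF this] obtain e q where eq: "e \<in> reduced" "q \<in> univariate s"
        "monomial c' - q * monomial e \<in> (J :: ('n, 'k) mpoly set)" by blast
    have "monomial c - q * monomial e \<in> (J :: ('n, 'k) mpoly set)"
      using idl.subspace_add[OF subspace_J cc eq(3)] by simp
    then show ?thesis using eq by blast
  next
    case False
    let ?e = "\<lambda>i. if i = s then 0 else c i" and ?q = "\<lambda>i. if i = s then c i else 0"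
    have "?e \<in> reduced" using False by (auto simp: reduced_def not_le)
    moreover have "monomial ?q \<in> univariate s" by (rule univariate_monomial) auto
    moreover have "(\<lambda>i. ?q i + ?e i) = c" by auto
    then have "monomial c - monomial ?q * monomial ?e \<in> (J :: ('n, 'k) mpoly set)"
      unfolding monomial_mult using idl.subspace_0[OF subspace_J] by simp
    ultimately show ?thesis by blast
  qed
qed

lemma mpoly_reduce:
  fixes u :: "('n, 'k::field) mpoly"
  shows "\<exists>p. (\<forall>e\<in>reduced. p e \<in> univariate s) \<and> u - (\<Sum>e\<in>reduced. p e * monomial e) \<in> J"
proof (induction u rule: mpoly_induct)
  case (single c a)
  obtain e q where eq: "e \<in> reduced" "q \<in> univariate s"
      "Poly_Mapping.single c 1 - q * monomial e \<in> (J :: ('n, 'k) mpoly set)"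
    using monomial_reduce[of "Poly_Mapping.lookup c"] unfolding single_eq_monomial by blast
  define \<alpha> where "\<alpha> = (Poly_Mapping.single 0 a :: ('n, 'k) mpoly)"
  have \<alpha>: "\<alpha> \<in> univariate s" by (simp add: \<alpha>_def univariate_def)
  define p where "p i = (if i = e then \<alpha> * q else 0)" for i
  have "(\<Sum>i\<in>reduced. p i * monomial i) = \<alpha> * q * monomial e"
    using eq(1) finite_reduced by (simp add: p_def if_distrib[of "\<lambda>c. c * _"] cong: if_cong)
  moreover have "Poly_Mapping.single c a = \<alpha> * Poly_Mapping.single c 1" by (simp add: \<alpha>_def mult_single)
  ultimately have "Poly_Mapping.single c a - (\<Sum>i\<in>reduced. p i * monomial i) =
      \<alpha> * (Poly_Mapping.single c 1 - q * monomial e)" by (simp add: right_diff_distrib mult.assoc)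
  then have "Poly_Mapping.single c a - (\<Sum>i\<in>reduced. p i * monomial i) \<in> J"
    using idl.subspace_scale[OF subspace_J eq(3)] by simp
  moreover have "\<forall>i\<in>reduced. p i \<in> univariate s"
    using eq(2) \<alpha> by (auto simp: p_def univariate_zero intro: univariate_mult)
  ultimately show ?case by blast
next
  case (add u v)
  then obtain p q where p: "\<forall>e\<in>reduced. p e \<in> univariate s" "u - (\<Sum>e\<in>reduced. p e * monomial e) \<in> J"
      and q: "\<forall>e\<in>reduced. q e \<in> univariate s" "v - (\<Sum>e\<in>reduced. q e * monomial e) \<in> J" by blast
  have "u + v - (\<Sum>e\<in>reduced. (p e + q e) * monomial e) \<in> J"
    using idl.subspace_add[OF subspace_J p(2) q(2)]
    by (simp add: distrib_right sum.distrib algebra_simps)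
  then show ?case using p(1) q(1) by (intro exI[of _ "\<lambda>e. p e + q e"]) (simp add: univariate_add)
qed

text \<open>Modulo \<open>J\<close> the elements have coordinate vectors of length
  \<open>card reduced\<close>, one less than their number; a relation between the coordinates lifts
  to one modulo \<open>J\<close>.\<close>

lemma dependent_mod_J:
  fixes w :: "nat \<Rightarrow> ('n, 'k::field) mpoly"
  shows "\<exists>q. (\<forall>k\<le>card reduced. q k \<in> univariate s) \<and> (\<exists>k\<le>card reduced. q k \<noteq> 0) \<and>
    (\<Sum>k\<le>card reduced. q k * w k) \<in> J"
proof -
  have "\<forall>k. \<exists>p. (\<forall>e\<in>reduced. p e \<in> univariate s) \<and> w k - (\<Sum>e\<in>reduced. p e * monomial e) \<in> J"
    by (intro allI mpoly_reduce)
  from choice[OF this] obtain p where p: "\<And>k. \<forall>e\<in>reduced. p k e \<in> univariate s"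
      "\<And>k. w k - (\<Sum>e\<in>reduced. p k e * monomial e) \<in> J" by blast
  have "\<exists>q. (\<forall>k\<in>{..card reduced}. q k \<in> univariate s) \<and> (\<exists>k\<in>{..card reduced}. q k \<noteq> 0) \<and>
      (\<forall>e\<in>reduced. (\<Sum>k\<in>{..card reduced}. q k * p k e) = 0)"
    by (rule linear_dependence)
      (use p(1) in \<open>auto simp: finite_reduced univariate_one
        intro: univariate_add univariate_mult univariate_uminus\<close>)
  then obtain q where q: "\<forall>k\<in>{..card reduced}. q k \<in> univariate s" "\<exists>k\<in>{..card reduced}. q k \<noteq> 0"
      "\<forall>e\<in>reduced. (\<Sum>k\<in>{..card reduced}. q k * p k e) = 0" by blast
  have "(\<Sum>k\<le>card reduced. q k * (\<Sum>e\<in>reduced. p k e * monomial e)) =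
      (\<Sum>e\<in>reduced. (\<Sum>k\<le>card reduced. q k * p k e) * monomial e)"
    unfolding sum_distrib_left sum_distrib_right mult.assoc by (rule sum.swap)
  also have "\<dots> = 0" using q(3) by simp
  finally have "(\<Sum>k\<le>card reduced. q k * w k) =
      (\<Sum>k\<le>card reduced. q k * (w k - (\<Sum>e\<in>reduced. p k e * monomial e)))"
    by (simp add: right_diff_distrib sum_subtractf)
  also have "\<dots> \<in> J"
    by (intro idl.subspace_sum[OF subspace_J] idl.subspace_scale[OF subspace_J] p)
  finally show ?thesis using q by (intro exI[of _ q]) auto
qed

sublocale finite_rank "univariate s" "J :: ('n, 'k::field) mpoly set" "card reduced"
proof
  show "1 \<in> (univariate s :: ('n, 'k) mpoly set)" by (rule univariate_one)
  show "x * y \<in> univariate s" if "x \<in> univariate s" "y \<in> univariate s" for x y :: "('n, 'k) mpoly"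
    using that by (rule univariate_mult)
qed (rule subspace_J dependent_mod_J)+

lemma pure_lattice_ideal: "pure (lattice_ideal (column_lattice L) :: ('n, 'k::field) mpoly set)"
  unfolding pure_def
proof (intro conjI ballI allI impI)
  show "J \<subseteq> (lattice_ideal (column_lattice L) :: ('n, 'k) mpoly set)"
    by (rule order_trans[OF J_subset_matrix_ideal matrix_ideal_subset_lattice_ideal])
qed (auto intro: subspace_lattice_ideal lattice_ideal_torsion_free)

section \<open>Components of the matrix ideal and its hull\<close>

lemma var_not_mem_rad_pure:
  assumes "pure Q" and "primary_ideal cring_class_ops (Q :: ('n, 'k::field) mpoly set)"
  shows "var s \<notin> rad Q"
proof
  have "monomial (\<lambda>j. if j = s then 1 else 0) \<in> (univariate s :: ('n, 'k) mpoly set)"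
    by (rule univariate_monomial) auto
  then have "var s \<in> (univariate s :: ('n, 'k) mpoly set)"
    using var_power_eq_monomial[of s 1, where 'k = 'k] by simp
  moreover assume "var s \<in> rad Q"
  ultimately have "var s = (0 :: ('n, 'k) mpoly)" by (rule rad_pure_primary_Int_T[OF assms])
  then show False
    using monomial_nonzero[of "\<lambda>j. if j = s then 1 else 0", where 'k = 'k]
      var_power_eq_monomial[of s 1, where 'k = 'k] by simp
qed

lemma constant_coeff_zero_subset:
  assumes "idl.subspace P" and "\<And>j. var j \<in> P" and "constant_coeff (u :: ('n, 'k::field) mpoly) = 0"
  shows "u \<in> P"
proof -
  have "\<exists>j\<in>UNIV. 1 \<le> Poly_Mapping.lookup e j" if "e \<in> Poly_Mapping.keys u" for e
  proof (rule ccontr)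
    assume "\<not> ?thesis"
    then have "e = 0" by (intro poly_mapping_eqI) (auto simp: not_le)
    then show False using that assms(3) by (simp add: constant_coeff_def in_keys_iff)
  qed
  then have "u \<in> idl.span ((\<lambda>j. var j ^ 1) ` UNIV)"
    unfolding span_var_powers by (intro CollectI ballI)
  also have "\<dots> \<subseteq> P" using assms(1,2) by (intro idl.span_minimal) auto
  finally show ?thesis .
qed

lemma lattice_ideal_power_var_cancel:
  assumes "var j ^ n * u \<in> (lattice_ideal (column_lattice L) :: ('n, 'k::field) mpoly set)"
  shows "u \<in> lattice_ideal (column_lattice L)"
  using assms unfolding var_power_eq_monomial by (rule lattice_ideal_monomial_cancel)

text \<open>Modulo the matrix ideal a power of each variable is a multiple of
  \<open>monomial c\<close>, so the radical contains all variables. Nothing in \<open>Q\<close> has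
  a constant term, so the radical is the maximal ideal of the origin.\<close>

lemma primary_ideal_matrix_ideal_plus_monomial:
  assumes "c s > 0"
  defines "Q \<equiv> idl.span (insert (monomial c) (matrix_ideal L)) :: ('n, 'k::field) mpoly set"
  shows "primary_ideal cring_class_ops Q" and "var s \<in> rad Q"
proof -
  have sub: "idl.subspace Q" by (simp add: Q_def)
  have var: "var j \<in> rad Q" for j
  proof -
    obtain M r where "var j ^ M - r * monomial c \<in> (matrix_ideal L :: ('n, 'k) mpoly set)"
      using var_power_cong_multiple by blast
    then have "var j ^ M - r * monomial c + r * monomial c \<in> Q"
      unfolding Q_def by (intro idl.span_add idl.span_scale) (auto intro: idl.span_base)
    then show ?thesis by (auto simp: rad_eq)
  qed
  then show "var s \<in> rad Q" .
  have "Abs_poly_mapping c \<noteq> 0"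
    using assms(1) lookup_Abs_exponent[of c] by (metis lookup_zero less_irrefl)
  then have "constant_coeff (monomial c :: ('n, 'k) mpoly) = 0"
    by (simp add: constant_coeff_def monomial_eq lookup_single when_def)
  then have Q0: "Q \<subseteq> {u. constant_coeff u = 0}"
    unfolding Q_def
    using constant_coeff_lattice_ideal[OF subsetD[OF matrix_ideal_subset_lattice_ideal]]
    by (intro idl.span_minimal subspace_constant_coeff) auto
  have rad: "u \<in> rad Q" if "constant_coeff u = 0" for u
    using constant_coeff_zero_subset[OF subspace_rad[OF sub] var that] .
  show "primary_ideal cring_class_ops Q"
  proof (rule primary_ideal_of_maximal_rad[OF sub])
    show "1 \<notin> Q" using Q0 by auto
    fix y assume "y \<notin> rad Q"
    then have y: "constant_coeff y \<noteq> 0" using rad by blast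
    let ?z = "Poly_Mapping.single 0 (inverse (constant_coeff y)) :: ('n, 'k) mpoly"
    have "constant_coeff (?z * y - 1) = 0"
      using y by (simp add: constant_coeff_minus constant_coeff_single_mult)
    then show "\<exists>z. z * y - 1 \<in> rad Q" using rad by blast
  qed
qed

text \<open>\<open>h\<close> multiplies the lattice ideal into the matrix ideal and is a scalar
  times a monomial modulo the lattice ideal; a power of \<open>var s\<close> carries that congruence
  over to the matrix ideal.\<close>

lemma lattice_ideal_colon_monomial:
  assumes h: "h * matrix_binomial L s \<in> (J :: ('n, 'k::field) mpoly set)"
    and mod: "h - Poly_Mapping.single 0 \<beta> * monomial m \<in> lattice_ideal (column_lattice L)" and "\<beta> \<noteq> 0"
  shows "\<exists>c. c s > 0 \<and> (\<forall>u \<in> lattice_ideal (column_lattice L). u * monomial c \<in> (matrix_ideal L :: ('n, 'k) mpoly set))"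
proof -
  obtain M where M: "var s ^ M * (h - Poly_Mapping.single 0 \<beta> * monomial m) \<in> matrix_ideal L"
    using lattice_ideal_power_var[OF mod] by blast
  \<comment> \<open>\<open>Suc M\<close> in place of \<open>M\<close> secures
    \<open>c s > 0\<close>.\<close>
  define c where "c i = (if i = s then Suc M else 0) + m i" for i
  have c: "monomial c = var s ^ Suc M * (monomial m :: ('n, 'k) mpoly)"
    unfolding var_power_eq_monomial monomial_mult c_def by simp
  have "u * monomial c \<in> (matrix_ideal L :: ('n, 'k) mpoly set)"
    if u: "u \<in> lattice_ideal (column_lattice L)" for u :: "('n, 'k) mpoly"
  proof -
    let ?i = "Poly_Mapping.single 0 (inverse \<beta>) :: ('n, 'k) mpoly" and ?b = "Poly_Mapping.single 0 \<beta> :: ('n, 'k) mpoly"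
    have "?i * ?b = 1" using \<open>\<beta> \<noteq> 0\<close> by (simp add: mult_single single_one)
    have uh: "u * h \<in> matrix_ideal L"
      using lattice_ideal_mult_mem_J[OF h u] J_subset_matrix_ideal by blast
    have "(var s ^ Suc M * ?i) * (u * h) - (var s * ?i * u) * (var s ^ M * (h - ?b * monomial m)) \<in> matrix_ideal L"
      by (intro idl.subspace_diff[OF subspace_matrix_ideal]
          idl.subspace_scale[OF subspace_matrix_ideal uh] idl.subspace_scale[OF subspace_matrix_ideal M])
    also have "(var s ^ Suc M * ?i) * (u * h) - (var s * ?i * u) * (var s ^ M * (h - ?b * monomial m)) =
        (?i * ?b) * (u * monomial c)"
      unfolding c by (simp add: algebra_simps)
    finally show ?thesis using \<open>?i * ?b = 1\<close> by simp
  qed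
  then show ?thesis by (intro exI[of _ c]) (simp add: c_def)
qed

text \<open>Some irredundant decomposition has only components that are pure or have
  \<open>var s\<close> in the radical. The pure ones are isolated and so contain any
  \<open>u\<close> in the hull; a power of \<open>var s\<close> takes \<open>u\<close> into the
  others, hence into the matrix ideal, and cancels modulo the lattice ideal.\<close>

lemma hull_subset_lattice_ideal:
  assumes c: "c s > 0" "\<And>u :: ('n, 'k::field) mpoly.
      u \<in> lattice_ideal (column_lattice L) \<Longrightarrow> u * monomial c \<in> matrix_ideal L"
  shows "hull_ideal cring_class_ops (matrix_ideal L) \<subseteq> (lattice_ideal (column_lattice L) :: ('n, 'k::field) mpoly set)"
proof
  let ?I = "matrix_ideal L :: ('n, 'k) mpoly set" and ?IL = "lattice_ideal (column_lattice L) :: ('n, 'k) mpoly set"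
  define Q0 where "Q0 = idl.span (insert (monomial c) ?I)"
  obtain E where E: "finite E" "\<forall>Q\<in>E. primary_ideal cring_class_ops Q \<and> pure Q" "\<Inter>E = ?IL"
    using pure_decomposition[OF pure_lattice_ideal] by blast
  have "Q0 \<inter> ?IL = ?I"
  proof
    show "?I \<subseteq> Q0 \<inter> ?IL"
      using matrix_ideal_subset_lattice_ideal unfolding Q0_def by (auto intro: idl.span_base)
    show "Q0 \<inter> ?IL \<subseteq> ?I"
    proof
      fix z assume z: "z \<in> Q0 \<inter> ?IL"
      have spanI: "idl.span ?I = ?I" using subspace_matrix_ideal by simp
      \<comment> \<open>Multiplying by \<open>monomial c\<close> shows that \<open>r\<close> lies in
        the lattice ideal, since monomials cancel there; then \<open>r * monomial c\<close> already
        lies in the matrix ideal.\<close>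
      obtain r where r: "z - r * monomial c \<in> ?I"
        using z unfolding Q0_def Int_iff idl.span_breakdown_eq spanI by blast
      have "z * monomial c \<in> ?I" using c(2) z by blast
      then have "z * monomial c - monomial c * (z - r * monomial c) \<in> ?I"
        by (rule idl.subspace_diff[OF subspace_matrix_ideal _ idl.subspace_scale[OF subspace_matrix_ideal r]])
      then have "monomial c * (monomial c * r) \<in> ?I" by (simp add: algebra_simps)
      then have "monomial c * (monomial c * r) \<in> ?IL"
        by (rule subsetD[OF matrix_ideal_subset_lattice_ideal])
      then have "r \<in> ?IL" using lattice_ideal_monomial_cancel by blast
      then have "r * monomial c \<in> ?I" by (rule c(2))
      from idl.subspace_add[OF subspace_matrix_ideal r this] show "z \<in> ?I" by simp
    qed
  qed
  then have Int: "\<Inter>(insert Q0 E) = ?I" using E(3) by simp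
  define C where "C Q \<longleftrightarrow> pure Q \<or> var s \<in> rad Q" for Q :: "('n, 'k) mpoly set"
  have CInt: "C (Q \<inter> Q')" if "primary_ideal cring_class_ops Q" "primary_ideal cring_class_ops Q'"
      "C Q" "C Q'" "rad Q = rad Q'" for Q Q'
    using that rad_Int[of Q Q'] pure_Int[of Q Q'] by (auto simp: C_def primary_ideal_iff)
  have "\<forall>Q\<in>insert Q0 E. primary_ideal cring_class_ops Q \<and> C Q"
    using primary_ideal_matrix_ideal_plus_monomial[of c, where 'k = 'k] c(1) E(2) by (auto simp: C_def Q0_def)
  then obtain D where D: "primary_decomposition cring_class_ops ?I D" "\<forall>Q\<in>D. C Q"
    using primary_decomposition_exists[of "insert Q0 E" C] E(1) CInt Int by auto
  have fin: "finite D" and prim: "\<And>Q. Q \<in> D \<Longrightarrow> primary_ideal cring_class_ops Q" and DI: "\<Inter>D = ?I"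
    using D(1) by (auto simp: primary_decomposition_iff)
  have isolated: "isolated_primary_component cring_class_ops ?I Q" if Q: "Q \<in> D" "pure Q" for Q
    unfolding isolated_primary_component_def
  proof (intro exI[of _ D] conjI ballI impI)
    \<comment> \<open>With \<open>rad Q'\<close> inside \<open>rad Q\<close>, \<open>var s\<close>
      is not in \<open>rad Q'\<close>, so \<open>Q'\<close> is pure and incomparability
      applies.\<close>
    fix Q' assume Q': "Q' \<in> D" "rad Q' \<subseteq> rad Q"
    then have "pure Q'" using var_not_mem_rad_pure[OF Q(2) prim[OF Q(1)]] D(2) by (auto simp: C_def)
    then show "rad Q' = rad Q"
      using rad_pure_primary_incomparable Q Q' prim by blast
  qed (use D Q in auto)
  fix u assume u: "u \<in> hull_ideal cring_class_ops ?I"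
  have "\<exists>n. var s ^ n * u \<in> Q" if Q: "Q \<in> D" for Q
  proof (cases "pure Q")
    case True
    then have "var s ^ 0 * u \<in> Q" using u isolated Q by (simp add: hull_ideal_eq)
    then show ?thesis by blast
  next
    case False
    then obtain n where "var s ^ n \<in> Q" using D(2) Q by (auto simp: C_def rad_eq)
    then have "u * var s ^ n \<in> Q" using prim[OF Q] idl.subspace_scale by (auto simp: primary_ideal_iff)
    then show ?thesis by (auto simp: mult.commute)
  qed
  then obtain n where n: "\<And>Q. Q \<in> D \<Longrightarrow> var s ^ n Q * u \<in> Q" by metis
  have "var s ^ (\<Sum>Q\<in>D. n Q) * u \<in> Q" if Q: "Q \<in> D" for Q
  proof -
    have "(\<Sum>Q\<in>D. n Q) = ((\<Sum>Q\<in>D. n Q) - n Q) + n Q" using member_le_sum[OF Q, of n] fin by simp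
    then have "var s ^ (\<Sum>Q\<in>D. n Q) * u = var s ^ ((\<Sum>Q\<in>D. n Q) - n Q) * (var s ^ n Q * u)"
      by (metis mult.assoc power_add)
    moreover have "idl.subspace Q" using prim[OF Q] by (simp add: primary_ideal_iff)
    ultimately show ?thesis using idl.subspace_scale[OF _ n[OF Q]] by metis
  qed
  then have "var s ^ (\<Sum>Q\<in>D. n Q) * u \<in> ?I" using DI by blast
  then have "var s ^ (\<Sum>Q\<in>D. n Q) * u \<in> ?IL" by (rule subsetD[OF matrix_ideal_subset_lattice_ideal])
  then show "u \<in> ?IL" by (rule lattice_ideal_power_var_cancel)
qed

text \<open>If \<open>t\<^sub>s\<close> lay in the radical \<open>P\<close> of an isolated component, \<open>P\<close> would contain all variables;
  the other components, which meet in the lattice ideal after removing powers of \<open>t\<^sub>s\<close>, would then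
  meet inside \<open>P\<close>, contradicting isolation.\<close>

lemma var_not_mem_rad_isolated:
  assumes "isolated_primary_component cring_class_ops (matrix_ideal L) (Q :: ('n, 'k::field) mpoly set)"
  shows "var s \<notin> rad Q"
proof
  let ?I = "matrix_ideal L :: ('n, 'k) mpoly set"
  assume s: "var s \<in> rad Q"
  obtain D where D: "primary_decomposition cring_class_ops ?I D" "Q \<in> D"
      "\<forall>Q'\<in>D. rad Q' \<subseteq> rad Q \<longrightarrow> rad Q' = rad Q"
    using assms unfolding isolated_primary_component_def by blast
  have prim: "\<And>Q. Q \<in> D \<Longrightarrow> primary_ideal cring_class_ops Q" and DI: "\<Inter>D = ?I" and fin: "finite D"
      and inj: "inj_on rad D"
    using D(1) by (auto simp: primary_decomposition_iff)
  have P: "primeideal (rad Q) cring_class_ops" using primeideal_rad prim D(2) by blast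
  then have subP: "idl.subspace (rad Q)" by (simp add: primeideal_iff)
  have var: "var j \<in> rad Q" for j
  proof (cases "j = s")
    case False
    then obtain z where z: "matrix_binomial L j = var j ^ nat (L $ j $ j) - var s * (z :: ('n, 'k) mpoly)"
      using tail_divisible by blast
    have "matrix_binomial L j \<in> ?I" unfolding matrix_ideal_eq_span by (intro idl.span_base) auto
    then have "matrix_binomial L j \<in> rad Q" using DI D(2) subset_rad by blast
    then have "matrix_binomial L j + z * var s \<in> rad Q"
      using idl.subspace_add[OF subP] idl.subspace_scale[OF subP s] by blast
    then have "var j ^ nat (L $ j $ j) \<in> rad Q" by (simp add: z mult.commute)
    then show ?thesis by (rule prime_power_mem[OF P])
  qed (use s in simp)
  obtain N where N: "var s ^ N \<in> Q" using s by (auto simp: rad_eq)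
  have "\<Inter>(D - {Q}) \<subseteq> rad Q"
  proof
    \<comment> \<open>A power of \<open>var s\<close> moves \<open>e\<close> into the matrix ideal;
      cancelling it in the lattice ideal shows that \<open>e\<close> has no constant term.\<close>
    fix e assume e: "e \<in> \<Inter>(D - {Q})"
    have "var s ^ N * e \<in> Q'" if "Q' \<in> D" for Q'
    proof (cases "Q' = Q")
      case True
      then show ?thesis
        using N prim[OF that] idl.subspace_scale[of Q "var s ^ N" e] by (simp add: primary_ideal_iff mult.commute)
    next
      case False
      then show ?thesis using e that prim[OF that] idl.subspace_scale by (auto simp: primary_ideal_iff)
    qed
    then have "var s ^ N * e \<in> ?I" using DI by blast
    then have "var s ^ N * e \<in> lattice_ideal (column_lattice L)"
      by (rule subsetD[OF matrix_ideal_subset_lattice_ideal])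
    then have "constant_coeff e = 0"
      by (rule constant_coeff_lattice_ideal[OF lattice_ideal_power_var_cancel])
    then show "e \<in> rad Q" by (rule constant_coeff_zero_subset[OF subP var])
  qed
  then obtain Q' where Q': "Q' \<in> D - {Q}" "Q' \<subseteq> rad Q"
    using prime_contains_of_Inter[OF P, of "D - {Q}"] fin prim by (auto simp: primary_ideal_iff)
  then have "rad Q' \<subseteq> rad Q" using rad_subset_prime[OF P] by blast
  then have "rad Q' = rad Q" using D(3) Q'(1) by blast
  then show False using inj Q'(1) D(2) by (auto dest: inj_onD)
qed

text \<open>The power of \<open>var s\<close> that moves \<open>u\<close> into the matrix ideal
  cancels modulo every isolated component, whose radical omits \<open>var s\<close>.\<close>

lemma lattice_ideal_subset_hull:
  "lattice_ideal (column_lattice L) \<subseteq> (hull_ideal cring_class_ops (matrix_ideal L) :: ('n, 'k::field) mpoly set)"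
  unfolding hull_ideal_eq
proof clarify
  fix u :: "('n, 'k) mpoly" and Q :: "('n, 'k) mpoly set"
  assume u: "u \<in> lattice_ideal (column_lattice L)"
    and Q: "isolated_primary_component cring_class_ops (matrix_ideal L) Q"
  obtain M where "var s ^ M * u \<in> matrix_ideal L" using lattice_ideal_power_var[OF u] by blast
  then have "u * var s ^ M \<in> Q"
    using subsetD[OF isolated_primary_component_contains(2)[OF Q]] by (simp add: mult.commute)
  then have "u \<in> Q \<or> (\<exists>n. (var s ^ M) ^ n \<in> Q)"
    using isolated_primary_component_contains(1)[OF Q] unfolding primary_ideal_iff by blast
  then show "u \<in> Q"
    using var_not_mem_rad_isolated[OF Q] by (auto simp: rad_eq simp flip: power_mult)
qed


section \<open>The vector b(s) and the telescoping substitution\<close>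

lemma scaled_matrix_nth: "scaled_matrix L b $ i $ j = L $ i $ j * b $ j"
  by (simp add: scaled_matrix_def matrix_matrix_mult_def if_distrib[of "\<lambda>c. _ * c"] cong: if_cong)

text \<open>The vanishing of row \<open>i\<close> of \<open>L *v b\<close> trades the entries from
  the diagonal on for those before it. In this form nonnegativity is visible, and the value 0 at the
  first index is an empty sum.\<close>

lemma b_exponent_eq:
  assumes "i \<noteq> Max UNIV"
  shows "b_exponent L b i = (\<Sum>j\<in>{..<i}. - (L $ i $ j * b $ j))"
proof (cases "i = Min UNIV")
  case True
  then have "{..<i} = {}" by (auto simp: not_less)
  then show ?thesis using True by (simp add: b_exponent_def)
next
  case False
  have "UNIV = insert i ({..<i} \<union> {i<..})" by auto
  then have "(\<Sum>j\<in>UNIV. L $ i $ j * b $ j) =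
      (\<Sum>j\<in>insert i ({..<i} \<union> {i<..}). L $ i $ j * b $ j)" by simp
  also have "\<dots> = L $ i $ i * b $ i + ((\<Sum>j\<in>{..<i}. L $ i $ j * b $ j) + (\<Sum>j\<in>{i<..}. L $ i $ j * b $ j))"
  proof -
    have "i \<notin> {..<i} \<union> {i<..}" "{..<i} \<inter> {i<..} = {}" by auto
    then show ?thesis by (simp add: sum.union_disjoint)
  qed
  finally show ?thesis
    using False assms L_b[of i] by (simp add: b_exponent_def scaled_matrix_nth sum_negf)
qed

lemma b_exponent_Max: "b_exponent L b (Max UNIV) = 0"
  by (simp add: b_exponent_def)

lemma b_exponent_nonneg: "0 \<le> b_exponent L b i"
proof (cases "i = Max UNIV")
  case False
  have "0 \<le> - (L $ i $ j * b $ j)" if "j \<in> {..<i}" for j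
  proof -
    have "i \<noteq> j" using that by auto
    then show ?thesis using off_diag b_pos by (simp add: less_imp_le mult_nonpos_nonneg)
  qed
  then show ?thesis unfolding b_exponent_eq[OF False] by (intro sum_nonneg) auto
qed (simp add: b_exponent_Max)

text \<open>Starting from \<open>t\<^bsup>b(s)\<^esup> y\<^sub>s\<^bsup>b\<^sub>s\<^esup>\<close>, replace \<open>x\<^sub>k\<^bsup>b\<^sub>k\<^esup>\<close> by \<open>y\<^sub>k\<^bsup>b\<^sub>k\<^esup>\<close> for
  \<open>k = s - 1, \<dots>, 1\<close> in turn: \<open>b(s)\<close> is chosen such that the exponent of \<open>t\<^sub>k\<close> is exactly
  \<open>a\<^sub>k\<^sub>,\<^sub>k b\<^sub>k\<close> when its turn comes.\<close>

lemma telescoping_mem_J: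
  assumes s: "s = Max UNIV"
  shows "monomial (\<lambda>i. nat (b_exponent L b i)) *
      (var s ^ (nat (L $ s $ s) * nat (b $ s)) - monomial (\<lambda>j. nat (- (L $ j $ s))) ^ nat (b $ s))
    \<in> (J :: ('n, 'k::field) mpoly set)"
proof -
  let ?\<beta> = "b_exponent L b"
  define c0 where "c0 i = nat (?\<beta> i) + nat (b $ s) * nat (- (L $ i $ s))" for i
  have le_s: "i \<le> s" for i by (simp add: s)
  have c0: "int (c0 i) = ?\<beta> i - (if i = s then 0 else L $ i $ s * b $ s)" for i
    using b_exponent_nonneg[of i] b_pos[of s] off_diag[of i s] diag[of s]
    by (cases "i = s") (auto simp: c0_def less_imp_le mult.commute)
  \<comment> \<open>\<open>A\<close> holds the indices already treated, a final segment below
    \<open>s\<close>; the induction inserts a new minimum, so the indices are treated in decreasing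
    order.\<close>
  have "\<exists>c. (\<forall>i. int (c i) = int (c0 i) - (\<Sum>j\<in>A. L $ i $ j * b $ j)) \<and>
      monomial c0 - monomial c \<in> (J :: ('n, 'k) mpoly set)"
    if "finite A" "A \<subseteq> UNIV - {s}" "\<forall>i\<in>A. {i<..<s} \<subseteq> A" for A
    using that
  proof (induction A rule: finite_linorder_min_induct)
    case empty
    then show ?case using idl.subspace_0[OF subspace_J] by (intro exI[of _ c0]) auto
  next
    case (insert k A)
    have ks: "k \<noteq> s" "k < s" using insert.prems le_s[of k] by auto
    have A: "A = {k<..<s}"
      using insert.hyps(2) insert.prems le_s by (auto simp: order.strict_iff_order)
    then have "A \<subseteq> UNIV - {s}" "\<forall>i\<in>A. {i<..<s} \<subseteq> A" by auto
    then obtain c where c: "\<And>i. int (c i) = int (c0 i) - (\<Sum>j\<in>A. L $ i $ j * b $ j)"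
        and cJ: "monomial c0 - monomial c \<in> (J :: ('n, 'k) mpoly set)"
      using insert.IH by blast
    have "UNIV = insert k (insert s ({..<k} \<union> A))" using A le_s by (auto simp: order.strict_iff_order)
    then have "0 = (\<Sum>j\<in>insert k (insert s ({..<k} \<union> A)). L $ k $ j * b $ j)"
      using L_b[of k] by simp
    also have "\<dots> = L $ k $ k * b $ k + (L $ k $ s * b $ s +
        ((\<Sum>j\<in>{..<k}. L $ k $ j * b $ j) + (\<Sum>j\<in>A. L $ k $ j * b $ j)))"
    proof -
      have "k \<notin> insert s ({..<k} \<union> A)" "s \<notin> {..<k} \<union> A" "{..<k} \<inter> A = {}" using A ks by auto
      then show ?thesis using insert.hyps(1) by (simp add: sum.union_disjoint)
    qed
    finally have ck: "int (c k) = L $ k $ k * b $ k"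
      using c[of k] c0[of k] ks b_exponent_eq[of k] s by (simp add: sum_negf)
    define c' where "c' i = nat (int (c i) - int (nat (b $ k)) * L $ i $ k)" for i
    have c': "int (c' i) = int (c i) - int (nat (b $ k)) * L $ i $ k" for i
    proof (cases "i = k")
      case True
      then show ?thesis using ck b_pos[of k] by (simp add: c'_def mult.commute)
    next
      case False
      then have "int (nat (b $ k)) * L $ i $ k \<le> 0"
        using off_diag[of i k] by (simp add: mult_nonneg_nonpos)
      then show ?thesis unfolding c'_def by simp
    qed
    have "int (nat (b $ k) * nat (L $ k $ k)) = int (c k)"
      using ck b_pos[of k] diag[of k] by (simp add: mult.commute)
    then have "nat (b $ k) * nat (L $ k $ k) \<le> c k" by linarith
    then obtain r where "monomial c - monomial c' = r * (matrix_binomial L k :: ('n, 'k) mpoly)"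
      using monomial_step[of c' c "nat (b $ k)" k, OF c'] by blast
    then have "monomial c - monomial c' \<in> (J :: ('n, 'k) mpoly set)"
      using matrix_binomial_dvd_J[OF ks(1)] by simp
    from idl.subspace_add[OF subspace_J cJ this]
    have "monomial c0 - monomial c' \<in> (J :: ('n, 'k) mpoly set)" by simp
    moreover have "int (c' i) = int (c0 i) - (\<Sum>j\<in>insert k A. L $ i $ j * b $ j)" for i
      using c'[of i] c[of i] A b_pos[of k] insert.hyps(1) by (simp add: mult.commute)
    ultimately show ?case by blast
  qed
  from this[of "UNIV - {s}"] obtain c where
    c: "\<And>i. int (c i) = int (c0 i) - (\<Sum>j\<in>UNIV - {s}. L $ i $ j * b $ j)"
    and cJ: "monomial c0 - monomial c \<in> (J :: ('n, 'k) mpoly set)"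
    by (auto simp: subset_iff)
  have "c i = nat (?\<beta> i) + (if i = s then nat (L $ s $ s) * nat (b $ s) else 0)" for i
  proof -
    \<comment> \<open>As the row sums vanish, subtracting all columns but \<open>s\<close> amounts
      to adding column \<open>s\<close>, which cancels the power of y_s and creates that of
      x_s.\<close>
    have "(\<Sum>j\<in>UNIV - {s}. L $ i $ j * b $ j) = - (L $ i $ s * b $ s)"
      using L_b[of i] sum.remove[of UNIV s "\<lambda>j. L $ i $ j * b $ j"] by simp
    then have "int (c i) = ?\<beta> i + (if i = s then L $ s $ s * b $ s else 0)"
      using c[of i] c0[of i] by simp
    also have "\<dots> = int (nat (?\<beta> i) + (if i = s then nat (L $ s $ s) * nat (b $ s) else 0))"
      using b_exponent_nonneg[of i] b_pos[of s] diag[of s] by simp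
    finally show ?thesis by (simp only: of_nat_eq_iff)
  qed
  then have "monomial (\<lambda>i. nat (?\<beta> i)) * var s ^ (nat (L $ s $ s) * nat (b $ s)) = (monomial c :: ('n, 'k) mpoly)"
    unfolding var_power_eq_monomial monomial_mult by presburger
  moreover have "monomial (\<lambda>i. nat (?\<beta> i)) * monomial (\<lambda>j. nat (- (L $ j $ s))) ^ nat (b $ s) = (monomial c0 :: ('n, 'k) mpoly)"
    unfolding monomial_power monomial_mult c0_def ..
  ultimately show ?thesis
    using idl.subspace_neg[OF subspace_J cJ] by (simp add: right_diff_distrib)
qed

end

section \<open>Comparison of the colon ideals with the lattice ideal and the hull\<close>

theorem proposition6p10:
  fixes L :: "((int, 'n) vec, 'n::{finite,linorder}) vec"
    and b :: "(int, 'n) vec"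
    and s :: 'n
    and f :: "'n \<Rightarrow> ('n, 'k::field) mpoly"
    and I J :: "('n, 'k) mpoly set"
    and IL :: "('n, 'k) mpoly set"
    and g x\<^sub>s y\<^sub>s g\<^sub>s t\<^sub>b :: "('n, 'k) mpoly"
  assumes "GPCB L"
    and "\<forall>i. b $ i > 0" and "(GCD i. b $ i) = 1" and "L *v b = 0"
    and "s = Max UNIV"
    and "CHAR('k) > 0 \<Longrightarrow> \<not> int CHAR('k) dvd b $ s"
    and "f = matrix_binomial L"
    and "I = matrix_ideal L"
    and "J = Idl\<^bsub>poly_ring\<^esub> (f ` (UNIV - {s}))"
    and "IL = lattice_ideal (column_lattice L)"
    and "g \<in> colon_ideal poly_ring J (f s)"
    and "\<And>P. minimal_prime_over poly_ring I P \<Longrightarrow> g \<notin> P"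
    and "x\<^sub>s = var s ^ nat (L $ s $ s)"
    and "y\<^sub>s = (\<Prod>j\<in>UNIV - {s}. var j ^ nat (- (L $ j $ s)))"
    and "g\<^sub>s = (\<Sum>j = 1..nat (b $ s). x\<^sub>s ^ (nat (b $ s) - j) * y\<^sub>s ^ (j - 1))"
    and "t\<^sub>b = monomial (\<lambda>i. nat (b_exponent L b i))"
  shows "(IL = hull_ideal poly_ring I \<and>
          hull_ideal poly_ring I = colon_ideal poly_ring I g \<and>
          colon_ideal poly_ring I g = colon_ideal poly_ring J g) \<and>
         ((\<forall>i. b_exponent L b i \<ge> 0) \<and>
          IL = colon_ideal poly_ring I (t\<^sub>b * g\<^sub>s) \<and>
          colon_ideal poly_ring I (t\<^sub>b * g\<^sub>s) = colon_ideal poly_ring J (t\<^sub>b * g\<^sub>s))"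
proof -
  interpret gpcb_matrix L b s
  proof
    show "(\<Sum>j\<in>UNIV. L $ i $ j * b $ j) = 0" for i
      using assms(4) by (simp add: matrix_vector_mult_def vec_eq_iff)
  qed (use assms(1,2) in \<open>auto simp: GPCB_def\<close>)
  \<comment> \<open>The explicit multiplier \<open>h\<close> serves twice: it gives part (b), and
    through \<open>lattice_ideal_colon_monomial\<close> it identifies the hull in part (a).\<close>
  define h where "h = t\<^sub>b * g\<^sub>s"
  have J: "J = gpcb_matrix.J L s"
    unfolding assms(7,9) local.J_def Idl_eq_span ..
  have subIL: "idl.subspace IL" unfolding assms(10) by (rule subspace_lattice_ideal)
  have JI: "J \<subseteq> I" unfolding J assms(8) by (rule J_subset_matrix_ideal)
  have I_IL: "I \<subseteq> IL" unfolding assms(8,10) by (rule matrix_ideal_subset_lattice_ideal)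
  have IL_J: "u * k \<in> J" if "u \<in> IL" "k * f s \<in> J" for u k
    using lattice_ideal_mult_mem_J[of k u] that unfolding J assms(7,10) by blast
  have y: "y\<^sub>s = monomial (\<lambda>j. nat (- (L $ j $ s)))"
    using matrix_binomial_eq[of s, where 'k = 'k] unfolding matrix_binomial_def assms(14)[symmetric]
      var_power_eq_monomial[symmetric] by simp
  have fs: "f s = x\<^sub>s - y\<^sub>s" unfolding assms(7,13,14) matrix_binomial_def ..
  have fsIL: "x\<^sub>s - y\<^sub>s \<in> IL"
  proof -
    have "f s \<in> I" unfolding assms(7,8) matrix_ideal_eq_span by (intro idl.span_base) auto
    then show ?thesis using I_IL fs by auto
  qed
  have "h * f s = t\<^sub>b * (x\<^sub>s ^ nat (b $ s) - y\<^sub>s ^ nat (b $ s))"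
    unfolding h_def fs assms(15) power_diff_factor[symmetric] by (simp add: mult_ac)
  also have "x\<^sub>s ^ nat (b $ s) = var s ^ (nat (L $ s $ s) * nat (b $ s))"
    unfolding assms(13) by (simp add: power_mult)
  finally have hJ: "h * f s \<in> J"
    using telescoping_mem_J[OF assms(5), where 'k = 'k] unfolding J y assms(16) by simp
  define \<beta> where "\<beta> = (of_nat (nat (b $ s)) :: 'k)"
  have \<beta>: "\<beta> \<noteq> 0"
  proof
    assume "\<beta> = 0"
    then have "CHAR('k) dvd nat (b $ s)" by (simp add: \<beta>_def of_nat_eq_0_iff_char_dvd)
    then have "int CHAR('k) dvd b $ s" using b_pos[of s] by (simp add: int_dvd_int_iff[symmetric])
    \<comment> \<open>In characteristic 0, divisibility by 0 contradicts the positivity of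
      \<open>b $ s\<close>.\<close>
    then show False using assms(6) b_pos[of s] by (cases "CHAR('k) = 0") auto
  qed
  \<comment> \<open>Modulo \<open>x\<^sub>s - y\<^sub>s\<close> each of the \<open>b $ s\<close>
    summands of \<open>g\<^sub>s\<close> becomes the same power of \<open>x\<^sub>s\<close>, whence
    this exponent.\<close>
  define m where "m i = nat (b_exponent L b i) + (if i = s then nat (L $ s $ s) * (nat (b $ s) - 1) else 0)" for i
  have m: "monomial m = t\<^sub>b * x\<^sub>s ^ (nat (b $ s) - 1)"
    unfolding assms(13,16) power_mult[symmetric]
    unfolding var_power_eq_monomial monomial_mult m_def ..
  have "t\<^sub>b * (g\<^sub>s - of_nat (nat (b $ s)) * x\<^sub>s ^ (nat (b $ s) - 1)) \<in> IL"
    unfolding assms(15) by (intro idl.subspace_scale[OF subIL] power_sum_cong[OF subIL fsIL])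
  also have "t\<^sub>b * (g\<^sub>s - of_nat (nat (b $ s)) * x\<^sub>s ^ (nat (b $ s) - 1)) =
      h - Poly_Mapping.single 0 \<beta> * monomial m"
    unfolding m h_def \<beta>_def by (simp add: right_diff_distrib mult.left_commute)
  finally have h_mod: "h - Poly_Mapping.single 0 \<beta> * monomial m \<in> IL" .
  obtain c where "c s > 0" "\<And>u. u \<in> IL \<Longrightarrow> u * monomial c \<in> I"
    using lattice_ideal_colon_monomial[of h \<beta> m] hJ h_mod \<beta> unfolding J assms(7,8,10) by blast
  then have hull: "hull_ideal poly_ring I = IL"
    using hull_subset_lattice_ideal[of c, where 'k = 'k] lattice_ideal_subset_hull[where 'k = 'k]
    unfolding assms(8,10) by blast
  have colon_g: "colon_ideal poly_ring I g \<subseteq> IL"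
    using colon_subset_hull[of I g, OF assms(12)] hull by (auto simp: colon_ideal_eq)
  \<comment> \<open>Modulo \<open>IL\<close>, \<open>h\<close> is a nonzero scalar times a monomial,
    and monomials cancel there.\<close>
  have "u \<in> IL" if "u * h \<in> I" for u
  proof -
    have "u * h - u * (h - Poly_Mapping.single 0 \<beta> * monomial m) \<in> IL"
      using that I_IL by (intro idl.subspace_diff[OF subIL] idl.subspace_scale[OF subIL h_mod]) auto
    then have "Poly_Mapping.single 0 (inverse \<beta>) * (u * (Poly_Mapping.single 0 \<beta> * monomial m)) \<in> IL"
      by (intro idl.subspace_scale[OF subIL, of "u * _"]) (simp add: right_diff_distrib)
    moreover have "Poly_Mapping.single 0 (inverse \<beta>) * (u * (Poly_Mapping.single 0 \<beta> * monomial m)) =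
        (Poly_Mapping.single 0 (inverse \<beta>) * Poly_Mapping.single 0 \<beta>) * (monomial m * u)"
      by (simp only: mult_ac)
    moreover have "Poly_Mapping.single 0 (inverse \<beta>) * Poly_Mapping.single 0 \<beta> = (1 :: ('n, 'k) mpoly)"
      using \<beta> by (simp add: mult_single single_one)
    ultimately have "monomial m * u \<in> IL" by simp
    then show ?thesis unfolding assms(10) by (rule lattice_ideal_monomial_cancel)
  qed
  then have colon_h: "colon_ideal poly_ring I h \<subseteq> IL" by (auto simp: colon_ideal_eq)
  \<comment> \<open>For \<open>g\<close> and \<open>h\<close> alike this leads from
    \<open>IL\<close> through the colon ideal of \<open>J\<close> to that of \<open>I\<close>;
    \<open>colon_g\<close> and \<open>colon_h\<close> close the circle.\<close>
  have colon: "IL \<subseteq> colon_ideal poly_ring J k" "colon_ideal poly_ring J k \<subseteq> colon_ideal poly_ring I k"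
    if "k * f s \<in> J" for k
    using IL_J[OF _ that] JI by (auto simp: colon_ideal_eq)
  have "g * f s \<in> J" using assms(11) by (simp add: colon_ideal_eq)
  from colon[OF this] colon[OF hJ] colon_g colon_h hull b_exponent_nonneg show ?thesis
    unfolding h_def by blast
qed

end
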